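(* For every $r\in\{0,\dots,m\}$, the underlying (combinatorial) trees of any two distinct elements $\Gamma,\Gamma'\in\mathrm{FW}_r=\Sigma_r\cap\bigcap_{q=1}^r\mathrm{Trop}(H_q)$ are distinct; that is, $\mathrm{FW}_r$ contains at most one point in the relative interior of each cone of $\mathcal M_{0,n}^{\mathrm{trop}}$.
   Context: Let $\mathbf k$ be an algebraically closed field of characteristic zero and $K=\mathbf k((t))$ with the $t$-adic valuation. Let $n\ge 3$, $[n]=\{1,\dots,n\}$, and $\mathcal M_{0,n}$ the moduli space of smooth rational $n$-marked curves over $\mathbf k$; superscript $K$ denotes base change. Tropical moduli space. $\mathcal M_{0,n}^{\mathrm{trop}}$ is the space of metric trees whose underlying tree is a stable $[n]$-marked tree (legs labelled by $[n]$, every vertex of valence at least 3 counting legs), with positive edge lengths and infinite legs; it is a cone complex with one cone for each stable tree $\tau$, whose relative interior consists of the metric trees with underlying tree $\tau$. $\mathcal M_{0,n}$ embeds in $\mathbb G_m^{\binom n2}/\mathbb G_m^n$ (where $(\lambda_\ell)$ acts by $p_{ab}\mapsto\lambda_a\lambda_bp_{ab}$) by sending $(\mathbb P^1,p_\bullet)$ to the $2\times2$ minors of the $2\times n$ matrix with columns $p_\ell$, and $\Gamma\mapsto-\frac12(d_{ab})_{a,b}$ ($d_{ab}$ the distance between the attaching points of legs $a,b$) identifies $\mathcal M_{0,n}^{\mathrm{trop}}$ with $\mathrm{Trop}(\mathcal M_{0,n})\subseteq\mathbb R^{\binom n2}/\mathbb R^n$. $\Sigma_r$ is the set of metric trees with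 at most $r$ edges. For a closed subscheme $X\subseteq\mathcal M_{0,n}^K$, $\mathrm{Trop}(X)\subseteq\mathcal M_{0,n}^{\mathrm{trop}}$ is the set of coordinatewise valuations of points of $X$ over valued extension fields of $K$. (For $r=0$ the set $\mathrm{FW}_0$ is the cone point.) The hypersurfaces. Let $m\le n-3$; for $q=1,\dots,m$ fix $S_q\subseteq[n]$ with $|S_q|\ge3$ and distinct $i_q,j_q\in S_q$. Fix an integer $B\ge 2n+1$. $H_q\subseteq\mathcal M_{0,n}^K$ is the hypersurface $\sum_{\ell\in S_q\setminus\{i_q,j_q\}}t^{\ell B^{n-3-q}}x_\ell=0$, where for $(\mathbb P^1,p_\bullet)$ one chooses the coordinate on $\mathbb P^1$ with $p_{i_q}=\infty$, $p_{j_q}=0$, and $x_\ell$ is the coordinate of $p_\ell$ (well-defined up to a common scalar). *)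

theory Defs
  imports
    "HOL-Algebra.Algebraic_Closure_Type"
    "HOL-Computational_Algebra.Formal_Laurent_Series"
    "Graph_Theory.Graph_Theory"
begin

section \<open>Stable marked trees and the tropical moduli space\<close>

text \<open>
  Graphs are finite symmetric loopfree digraphs on natural numbers (every finite tree has a copy
  there), so an undirected edge is a pair of opposite arcs.  The predicate \<^const>\<open>Digraph_Component.tree\<close>
  is not usable for these: its notion of cycle is directed and admits length 2, so going back and
  forth along an edge is a cycle.
\<close>

definition undirected_tree :: "'a pair_pre_digraph \<Rightarrow> bool" where
  "undirected_tree T \<longleftrightarrow> pair_graph T \<and> pverts T \<noteq> {} \<and>
     (\<forall>u\<in>pverts T. \<forall>v\<in>pverts T. \<exists>!p. pre_digraph.apath (with_proj T) u p v)"

definition edges :: "'a pair_pre_digraph \<Rightarrow> 'a set set" where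
  "edges T = {{u, v} |u v. (u, v) \<in> parcs T}"

record marked_tree =
  graph_of :: "nat pair_pre_digraph"
  leg :: "nat \<Rightarrow> nat"  \<comment> \<open>the vertex to which a leg is attached; only labels in \<open>{1..n}\<close> matter\<close>

text \<open>The out-degree of a vertex is the number of undirected edges at it.\<close>

definition stable_trees :: "nat \<Rightarrow> marked_tree set" where
  "stable_trees n = {\<tau>. undirected_tree (graph_of \<tau>) \<and> leg \<tau> ` {1..n} \<subseteq> pverts (graph_of \<tau>) \<and>
     (\<forall>v\<in>pverts (graph_of \<tau>).
        out_degree (with_proj (graph_of \<tau>)) v + card {a\<in>{1..n}. leg \<tau> a = v} \<ge> 3)}"

type_synonym metric_tree = "marked_tree \<times> (nat set \<Rightarrow> real)"

definition metric_trees :: "nat \<Rightarrow> metric_tree set" where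
  "metric_trees n = {(\<tau>, len). \<tau> \<in> stable_trees n \<and> (\<forall>e\<in>edges (graph_of \<tau>). len e > 0)}"

definition tree_iso :: "nat \<Rightarrow> (nat \<Rightarrow> nat) \<Rightarrow> marked_tree \<Rightarrow> marked_tree \<Rightarrow> bool" where
  "tree_iso n f \<tau> \<tau>' \<longleftrightarrow>
     bij_betw f (pverts (graph_of \<tau>)) (pverts (graph_of \<tau>')) \<and>
     (\<forall>u\<in>pverts (graph_of \<tau>). \<forall>v\<in>pverts (graph_of \<tau>).
        (u, v) \<in> parcs (graph_of \<tau>) \<longleftrightarrow> (f u, f v) \<in> parcs (graph_of \<tau>')) \<and>
     (\<forall>a\<in>{1..n}. leg \<tau>' a = f (leg \<tau> a))"

definition tree_rel :: "nat \<Rightarrow> marked_tree rel" where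
  "tree_rel n = {(\<tau>, \<tau>'). \<tau> \<in> stable_trees n \<and> \<tau>' \<in> stable_trees n \<and> (\<exists>f. tree_iso n f \<tau> \<tau>')}"

definition metric_rel :: "nat \<Rightarrow> metric_tree rel" where
  "metric_rel n = {((\<tau>, len), (\<tau>', len')).
     (\<tau>, len) \<in> metric_trees n \<and> (\<tau>', len') \<in> metric_trees n \<and>
     (\<exists>f. tree_iso n f \<tau> \<tau>' \<and> (\<forall>e\<in>edges (graph_of \<tau>). len' (f ` e) = len e))}"

text \<open>
  The points of the tropical moduli space are isomorphism classes of metric trees, its cones
  correspond to isomorphism classes of stable trees.
\<close>

definition M0n_trop :: "nat \<Rightarrow> metric_tree set set" where
  "M0n_trop n = metric_trees n // metric_rel n"

definition underlying_tree :: "nat \<Rightarrow> metric_tree set \<Rightarrow> marked_tree set" where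
  "underlying_tree n \<Gamma> = tree_rel n `` (fst ` \<Gamma>)"

definition cone_relint :: "nat \<Rightarrow> marked_tree set \<Rightarrow> metric_tree set set" where
  "cone_relint n c = {\<Gamma> \<in> M0n_trop n. underlying_tree n \<Gamma> = c}"

definition Sigma_trop :: "nat \<Rightarrow> nat \<Rightarrow> metric_tree set set" where
  "Sigma_trop n r = {\<Gamma> \<in> M0n_trop n. \<exists>(\<tau>, len)\<in>\<Gamma>. card (edges (graph_of \<tau>)) \<le> r}"

definition leg_dist :: "metric_tree \<Rightarrow> nat \<Rightarrow> nat \<Rightarrow> real" where
  "leg_dist \<Gamma> a b = (case \<Gamma> of (\<tau>, len) \<Rightarrow>
     sum_list (map (\<lambda>(u, v). len {u, v})
       (THE p. pre_digraph.apath (with_proj (graph_of \<tau>)) (leg \<tau> a) p (leg \<tau> b))))"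

text \<open>Equality of vectors indexed by pairs \<open>a < b\<close>, modulo the image of \<open>c \<mapsto> (c a + c b)\<close>.\<close>

definition lineality_equiv :: "nat \<Rightarrow> (nat \<Rightarrow> nat \<Rightarrow> real) \<Rightarrow> (nat \<Rightarrow> nat \<Rightarrow> real) \<Rightarrow> bool" where
  "lineality_equiv n w w' \<longleftrightarrow>
     (\<exists>c. \<forall>a\<in>{1..n}. \<forall>b\<in>{1..n}. a < b \<longrightarrow> w' a b = c a + c b + w a b)"


section \<open>Valued extension fields of the Laurent series field\<close>

text \<open>The value at zero is \<open>\<infinity>\<close> by convention; \<open>v \<zero>\<close> is junk and never used.\<close>

definition real_valuation :: "'u ring \<Rightarrow> ('u \<Rightarrow> real) \<Rightarrow> bool" where
  "real_valuation L v \<longleftrightarrow>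
     (\<forall>x\<in>carrier L - {\<zero>\<^bsub>L\<^esub>}. \<forall>y\<in>carrier L - {\<zero>\<^bsub>L\<^esub>}.
        v (x \<otimes>\<^bsub>L\<^esub> y) = v x + v y \<and>
        (x \<oplus>\<^bsub>L\<^esub> y \<noteq> \<zero>\<^bsub>L\<^esub> \<longrightarrow> v (x \<oplus>\<^bsub>L\<^esub> y) \<ge> min (v x) (v y)))"

text \<open>
  \<open>'k fls\<close> is the field of Laurent series with the valuation \<^const>\<open>fls_subdegree\<close>; \<open>\<phi>\<close> is the
  structure map of the extension.
\<close>

definition valued_extension ::
    "'u ring \<Rightarrow> ('k::{alg_closed_field,field_char_0} fls \<Rightarrow> 'u) \<Rightarrow> ('u \<Rightarrow> real) \<Rightarrow> bool" where
  "valued_extension L \<phi> v \<longleftrightarrow>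
     field L \<and> \<phi> \<in> ring_hom ring_of_type_algebra L \<and> real_valuation L v \<and>
     (\<forall>f. f \<noteq> 0 \<longrightarrow> v (\<phi> f) = real_of_int (fls_subdegree f))"


section \<open>The moduli space of marked rational curves\<close>

text \<open>
  An \<open>L\<close>-point is the projective line over \<open>L\<close> with \<open>n\<close> distinct \<open>L\<close>-points, represented by a
  2 by n matrix whose columns \<open>p a\<close> are homogeneous coordinates.  Two of the points are distinct iff
  the corresponding minor is nonzero.
\<close>

definition minor :: "'u ring \<Rightarrow> (nat \<Rightarrow> 'u \<times> 'u) \<Rightarrow> nat \<Rightarrow> nat \<Rightarrow> 'u" where
  "minor L p a b = fst (p a) \<otimes>\<^bsub>L\<^esub> snd (p b) \<ominus>\<^bsub>L\<^esub> snd (p a) \<otimes>\<^bsub>L\<^esub> fst (p b)"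

definition marked_line :: "'u ring \<Rightarrow> nat \<Rightarrow> (nat \<Rightarrow> 'u \<times> 'u) \<Rightarrow> bool" where
  "marked_line L n p \<longleftrightarrow> (\<forall>a\<in>{1..n}. p a \<in> carrier L \<times> carrier L) \<and>
     (\<forall>a\<in>{1..n}. \<forall>b\<in>{1..n}. a \<noteq> b \<longrightarrow> minor L p a b \<noteq> \<zero>\<^bsub>L\<^esub>)"

text \<open>
  A closed subscheme of the base change to \<open>'k fls\<close> enters through its points: \<open>Z L \<phi> p\<close> states that
  the marked line \<open>p\<close> over the extension \<open>\<phi>\<close> with field \<open>L\<close> lies on it.
\<close>

type_synonym ('k, 'u) subscheme = "'u ring \<Rightarrow> ('k fls \<Rightarrow> 'u) \<Rightarrow> (nat \<Rightarrow> 'u \<times> 'u) \<Rightarrow> bool"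

text \<open>
  HOL cannot quantify over the fields of all types at once, so the extension fields range over all
  fields whose carrier is a subset of the type \<open>'u\<close>.  A statement about \<open>Trop n Z\<close> that is made for
  every \<open>'u\<close> and uses membership only as a hypothesis is a statement about all extension
  fields: finitely many of them always have copies inside one type.
\<close>

definition Trop :: "nat \<Rightarrow> ('k::{alg_closed_field,field_char_0}, 'u) subscheme \<Rightarrow> metric_tree set set"
  where
  "Trop n Z = {\<Gamma> \<in> M0n_trop n. \<exists>T\<in>\<Gamma>. \<exists>L \<phi> v p.
     valued_extension L \<phi> v \<and> marked_line L n p \<and> Z L \<phi> p \<and>
     lineality_equiv n (\<lambda>a b. v (minor L p a b)) (\<lambda>a b. - leg_dist T a b / 2)}"

text \<open>
  \<open>x\<close> lists the coordinates of the marked points other than \<open>p i\<close> after the projective transformation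
  \<open>[X : Y] \<mapsto> [\<alpha> X + \<beta> Y : \<gamma> X + \<delta> Y]\<close>, which is required to send \<open>p i\<close> to \<open>\<infinity> = [1 : 0]\<close> and \<open>p j\<close> to
  \<open>0 = [0 : 1]\<close>.  The last line says \<open>x l = (\<alpha> X + \<beta> Y) / (\<gamma> X + \<delta> Y)\<close> at \<open>p l = [X : Y]\<close>; the
  denominator vanishes only at \<open>p i\<close>.
\<close>

definition affine_coordinates ::
    "'u ring \<Rightarrow> nat \<Rightarrow> (nat \<Rightarrow> 'u \<times> 'u) \<Rightarrow> nat \<Rightarrow> nat \<Rightarrow> (nat \<Rightarrow> 'u) \<Rightarrow> bool" where
  "affine_coordinates L n p i j x \<longleftrightarrow>
     (\<exists>\<alpha>\<in>carrier L. \<exists>\<beta>\<in>carrier L. \<exists>\<gamma>\<in>carrier L. \<exists>\<delta>\<in>carrier L.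
        \<alpha> \<otimes>\<^bsub>L\<^esub> \<delta> \<ominus>\<^bsub>L\<^esub> \<beta> \<otimes>\<^bsub>L\<^esub> \<gamma> \<noteq> \<zero>\<^bsub>L\<^esub> \<and>
        \<gamma> \<otimes>\<^bsub>L\<^esub> fst (p i) \<oplus>\<^bsub>L\<^esub> \<delta> \<otimes>\<^bsub>L\<^esub> snd (p i) = \<zero>\<^bsub>L\<^esub> \<and>
        \<alpha> \<otimes>\<^bsub>L\<^esub> fst (p j) \<oplus>\<^bsub>L\<^esub> \<beta> \<otimes>\<^bsub>L\<^esub> snd (p j) = \<zero>\<^bsub>L\<^esub> \<and>
        (\<forall>l\<in>{1..n} - {i}. x l \<in> carrier L \<and>
           \<alpha> \<otimes>\<^bsub>L\<^esub> fst (p l) \<oplus>\<^bsub>L\<^esub> \<beta> \<otimes>\<^bsub>L\<^esub> snd (p l)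
             = x l \<otimes>\<^bsub>L\<^esub> (\<gamma> \<otimes>\<^bsub>L\<^esub> fst (p l) \<oplus>\<^bsub>L\<^esub> \<delta> \<otimes>\<^bsub>L\<^esub> snd (p l))))"

text \<open>
  The coordinates are unique up to a common nonzero factor, so it does not matter which ones are
  chosen to test the equation.
\<close>

definition hypersurface :: "nat \<Rightarrow> nat \<Rightarrow> nat set \<Rightarrow> nat \<Rightarrow> nat \<Rightarrow> nat \<Rightarrow>
    ('k::{alg_closed_field,field_char_0}, 'u) subscheme" where
  "hypersurface n B S i j q L \<phi> p \<longleftrightarrow> (\<exists>x. affine_coordinates L n p i j x \<and>
     (\<Oplus>\<^bsub>L\<^esub>l\<in>S - {i, j}. \<phi> (fls_X ^ (l * B ^ (n - 3 - q))) \<otimes>\<^bsub>L\<^esub> x l) = \<zero>\<^bsub>L\<^esub>)"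

definition FW :: "'k::{alg_closed_field,field_char_0} itself \<Rightarrow> 'u itself \<Rightarrow> nat \<Rightarrow> nat \<Rightarrow>
    (nat \<Rightarrow> nat set) \<Rightarrow> (nat \<Rightarrow> nat) \<Rightarrow> (nat \<Rightarrow> nat) \<Rightarrow> nat \<Rightarrow> metric_tree set set" where
  "FW _ _ n B S i j r = Sigma_trop n r \<inter>
     (\<Inter>q\<in>{1..r}. Trop n (hypersurface n B (S q) (i q) (j q) q :: ('k, 'u) subscheme))"

end

theory Submission
  imports Defs "HOL-Library.Sublist"
begin

text \<open>
  In the coordinate with \<open>p i = \<infinity>\<close> and \<open>p j = 0\<close>, the point \<open>p l\<close> has coordinate
  \<open>x l = [l j] / [l i]\<close> up to a common factor, where the brackets are minors.  Its valuation is therefore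
  \<open>(d(l, i) - d(l, j)) / 2\<close> up to a common constant, and in a tree this number is, again up to a
  constant, the length of the stem of \<open>l\<close>: the part of the path from \<open>i\<close> to \<open>j\<close> before the path to
  \<open>l\<close> branches off.  If finitely many elements of a valued field add up to zero, then the minimum of
  their valuations is attained twice.  So a metric tree on the tropicalization of the hypersurface
  with index \<open>q\<close> satisfies the condition that the minimum over \<open>l \<in> S - {i, j}\<close> of
  \<open>l W\<^sub>q + length (stem of l)\<close>, \<open>W\<^sub>q = B ^ (n - 3 - q)\<close>, is attained twice
  (\<open>Trop_hypersurface_min\<close>).  The rest of the argument uses only these conditions and that, for
  fixed \<open>q\<close>, the stems form a chain of edge sets.

  Let the minimum for \<open>q\<close> be attained at \<open>l0\<close> and \<open>l1\<close>, with the shorter stem at \<open>l0\<close>.  The edges \<open>P\<^sub>q\<close> by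
  which the two stems differ have total length \<open>(l0 - l1) W\<^sub>q\<close>, which lies between \<open>W\<^sub>q\<close> and
  \<open>(n - 1) W\<^sub>q\<close>.  As \<open>B > 2 n\<close>, the sets \<open>P\<^sub>s\<close> with \<open>s > q\<close> together are shorter than \<open>P\<^sub>q\<close>, so \<open>P\<^sub>q\<close>
  contains an edge \<open>\<epsilon> q\<close> that belongs to none of them.  These edges are distinct.  A tree with at
  most \<open>r\<close> edges that meets \<open>r\<close> such conditions hence has exactly the edges \<open>\<epsilon> 1, ..., \<epsilon> r\<close>, and
  \<open>\<epsilon> q\<close> lives on the scale \<open>W\<^sub>q\<close> (\<open>leading_edges\<close>).

  For two metrics on the same tree, one shows by induction on \<open>q\<close> from \<open>r\<close> down to 1 that the edges
  \<open>\<epsilon> q\<close> agree and have the same length (\<open>leading_determined\<close>).  Let \<open>U\<close> be the set of the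
  edges already treated.  No label can branch off before an edge outside \<open>U\<close> that precedes \<open>\<epsilon> q\<close>,
  since the gain of that edge, which is longer than \<open>(n - 1) W\<^sub>q\<close>, would beat the minimum
  (\<open>first_long_edge\<close>).  So \<open>\<epsilon> q\<close> is the first edge outside \<open>U\<close> on the path from \<open>i\<close> to \<open>j\<close> that has
  labels branching off before it, which does not refer to the metric.  Its length is the
  difference of two minima in which, up to a common summand, only the edges in \<open>U\<close> enter, so it is
  determined as well.
\<close>

section \<open>Chains of edges on separated scales\<close>

definition min_attained_twice :: "'a set \<Rightarrow> ('a \<Rightarrow> real) \<Rightarrow> bool" where
  "min_attained_twice A g \<longleftrightarrow> (\<exists>a\<in>A. \<exists>b\<in>A. a \<noteq> b \<and> g a = g b \<and> (\<forall>c\<in>A. g a \<le> g c))"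

lemma min_attained_twice_shift:
  assumes "\<And>a. a \<in> A \<Longrightarrow> g a = h a + C"
  shows "min_attained_twice A g \<longleftrightarrow> min_attained_twice A h"
  unfolding min_attained_twice_def using assms by simp

lemma sum_UNION_le:
  fixes f :: "'a \<Rightarrow> real"
  assumes "finite I" and "\<And>i. i \<in> I \<Longrightarrow> finite (P i)" and "\<And>i x. i \<in> I \<Longrightarrow> x \<in> P i \<Longrightarrow> 0 \<le> f x"
  shows "sum f (\<Union>i\<in>I. P i) \<le> (\<Sum>i\<in>I. sum f (P i))"
  using assms
proof (induction I rule: finite_induct)
  case (insert i I)
  have "sum f (P i \<union> (\<Union>i\<in>I. P i)) + sum f (P i \<inter> (\<Union>i\<in>I. P i))
      = sum f (P i) + sum f (\<Union>i\<in>I. P i)"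
    using insert by (intro sum.union_inter) auto
  moreover have "0 \<le> sum f (P i \<inter> (\<Union>i\<in>I. P i))"
    using insert.prems by (intro sum_nonneg) auto
  ultimately show ?case using insert by fastforce
qed simp

text \<open>
  The edge set \<open>N q l\<close> plays the role of the stem of the label \<open>l\<close> for the hypersurface with index
  \<open>q\<close>, and \<open>A q\<close> that of the set of labels in its equation.
\<close>

locale scaled_chains =
  fixes n B M r :: nat and E :: "'e set" and A :: "nat \<Rightarrow> nat set" and N :: "nat \<Rightarrow> nat \<Rightarrow> 'e set"
  assumes finite_edges: "finite E" and card_edges: "card E \<le> r"
    and r_le: "r \<le> M" and base: "B \<ge> 2 * n + 1"
    and labels: "\<And>q. q \<in> {1..r} \<Longrightarrow> A q \<subseteq> {1..n}"
    and chain_edges: "\<And>q l. q \<in> {1..r} \<Longrightarrow> l \<in> A q \<Longrightarrow> N q l \<subseteq> E"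
    and chain: "\<And>q l l'. q \<in> {1..r} \<Longrightarrow> l \<in> A q \<Longrightarrow> l' \<in> A q \<Longrightarrow> N q l \<subseteq> N q l' \<or> N q l' \<subseteq> N q l"
begin

definition W :: "nat \<Rightarrow> real" where "W q = real B ^ (M - q)"

definition solution :: "('e \<Rightarrow> real) \<Rightarrow> bool" where
  "solution len \<longleftrightarrow> (\<forall>e\<in>E. 0 < len e) \<and>
     (\<forall>q\<in>{1..r}. min_attained_twice (A q) (\<lambda>l. real l * W q + sum len (N q l)))"

lemma B_pos: "real B \<ge> 1" using base by auto

lemma W_pos: "W q > 0" using B_pos by (simp add: W_def)

lemma W_Suc: "q < r \<Longrightarrow> W q = real B * W (Suc q)"
  using r_le by (simp add: W_def Suc_diff_Suc flip: power_Suc)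

lemma W_antimono: "s \<le> q \<Longrightarrow> W q \<le> W s"
  unfolding W_def using B_pos by (intro power_increasing) auto

text \<open>
  The factor \<open>2 n\<close> leaves room for the coefficients below \<open>n\<close> in front of the weights and for halving:
  an edge that loses the contributions of all smaller scales keeps half of its own.
\<close>

lemma W_tail: 
  assumes "q \<le> r" shows "2 * real n * sum W {Suc q..r} \<le> W q"
  using assms
proof (induction q rule: inc_induct)
  case base show ?case using W_pos[of r] by simp
next
  case (step q)
  have "2 * real n * sum W {Suc q..r} = 2 * real n * W (Suc q) + 2 * real n * sum W {Suc (Suc q)..r}"
    using step by (subst sum.atLeast_Suc_atMost) (auto simp: algebra_simps)
  also have "\<dots> \<le> (2 * real n + 1) * W (Suc q)" using step by (simp add: algebra_simps)
  also have "\<dots> \<le> real B * W (Suc q)" using base W_pos[of "Suc q"] by (intro mult_right_mono) auto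
  also have "\<dots> = W q" using step W_Suc by simp
  finally show ?case .
qed

text \<open>
  The minimum for \<open>q\<close> is attained at \<open>l0\<close> and \<open>l1\<close>, whose stems differ by \<open>b\<close> and perhaps by some edges
  in \<open>U\<close>.  In the applications \<open>U\<close> consists of the edges of smaller scales, and all edges besides
  these and \<open>b\<close> are so long that they outweigh any difference of two labels.
\<close>

definition leading :: "('e \<Rightarrow> real) \<Rightarrow> nat \<Rightarrow> 'e set \<Rightarrow> 'e \<Rightarrow> nat \<Rightarrow> nat \<Rightarrow> bool" where
  "leading len q U b l0 l1 \<longleftrightarrow>
     l0 \<in> A q \<and> l1 \<in> A q \<and>
     real l0 * W q + sum len (N q l0) = real l1 * W q + sum len (N q l1) \<and>
     (\<forall>l\<in>A q. real l0 * W q + sum len (N q l0) \<le> real l * W q + sum len (N q l)) \<and>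
     N q l0 \<subseteq> N q l1 \<and> b \<in> N q l1 - N q l0 - U \<and> N q l1 - N q l0 \<subseteq> insert b U \<and>
     (\<forall>e\<in>E - U - {b}. (real n - 1) * W q < len e)"

text \<open>
  The bound on the number of edges enters here: \<open>r\<close> different scales need \<open>r\<close> different edges, so
  nothing is left over.
\<close>

lemma leading_edges:
  assumes sol: "solution len"
  shows "\<exists>\<epsilon>. bij_betw \<epsilon> {1..r} E \<and> (\<forall>q\<in>{1..r}. \<exists>l0 l1. leading len q (\<epsilon> ` {q<..r}) (\<epsilon> q) l0 l1)"
proof -
  have pos: "0 < len e" if "e \<in> E" for e using sol that by (auto simp: solution_def)
  have nonneg: "0 \<le> sum len F" if "F \<subseteq> E" for F using pos that by (intro sum_nonneg) (force intro: less_imp_le)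
  have mono: "sum len F \<le> sum len G" if "F \<subseteq> G" "G \<subseteq> E" for F G
    using that pos finite_edges by (intro sum_mono2) (auto intro: finite_subset less_imp_le)
  define g where "g q l = real l * W q + sum len (N q l)" for q l
  have "\<exists>l0 l1. l0 \<in> A q \<and> l1 \<in> A q \<and> l1 < l0 \<and> g q l0 = g q l1 \<and> (\<forall>l\<in>A q. g q l0 \<le> g q l)"
    if q: "q \<in> {1..r}" for q
  proof -
    obtain a b where ab: "a \<in> A q" "b \<in> A q" "a \<noteq> b" "g q a = g q b" "\<forall>l\<in>A q. g q a \<le> g q l"
      using sol q unfolding solution_def min_attained_twice_def g_def by blast
    then show ?thesis by (cases "a < b") (metis linorder_neqE_nat)+
  qed
  then obtain l0 l1 where l: "\<And>q. q \<in> {1..r} \<Longrightarrow> l0 q \<in> A q \<and> l1 q \<in> A q \<and> l1 q < l0 q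
      \<and> g q (l0 q) = g q (l1 q) \<and> (\<forall>l\<in>A q. g q (l0 q) \<le> g q l)"
    by metis
  \<comment> \<open>\<open>P q\<close> has length of order \<open>W q\<close>, because \<open>1 \<le> l0 q - l1 q \<le> n - 1\<close>.\<close>
  define P where "P q = N q (l1 q) - N q (l0 q)" for q
  have PE: "P q \<subseteq> E" if "q \<in> {1..r}" for q using chain_edges[OF that] l[OF that] by (auto simp: P_def)
  have diff: "sum len (N q (l1 q)) - sum len (N q (l0 q)) = (real (l0 q) - real (l1 q)) * W q"
    if "q \<in> {1..r}" for q
    using l[OF that] by (simp add: g_def algebra_simps)
  have sub: "N q (l0 q) \<subseteq> N q (l1 q)" if q: "q \<in> {1..r}" for q
  proof (rule ccontr)
    assume "\<not> ?thesis"
    then have "N q (l1 q) \<subseteq> N q (l0 q)" using chain[OF q] l[OF q] by blast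
    then have "sum len (N q (l1 q)) \<le> sum len (N q (l0 q))" using chain_edges[OF q] l[OF q] by (intro mono) auto
    moreover have "0 < (real (l0 q) - real (l1 q)) * W q" using l[OF q] W_pos by simp
    ultimately show False using diff[OF q] by simp
  qed
  have lenP: "sum len (P q) = (real (l0 q) - real (l1 q)) * W q" if q: "q \<in> {1..r}" for q
    unfolding P_def diff[OF q, symmetric] using sub[OF q] l[OF q] chain_edges[OF q] finite_edges
    by (intro sum_diff) (auto intro: finite_subset)
  have lenP_ge: "W q \<le> sum len (P q)" if q: "q \<in> {1..r}" for q
  proof -
    have "1 * W q \<le> (real (l0 q) - real (l1 q)) * W q"
      using l[OF q] W_pos[of q] by (intro mult_right_mono) auto
    then show ?thesis using lenP[OF q] by simp
  qed
  have lenP_le: "sum len (P q) \<le> (real n - 1) * W q" if q: "q \<in> {1..r}" for q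
  proof -
    have "l0 q \<in> {1..n}" "l1 q \<in> {1..n}" using l[OF q] labels[OF q] by auto
    then show ?thesis unfolding lenP[OF q] using W_pos[of q] by (intro mult_right_mono) auto
  qed
  have tail: "2 * (\<Sum>s\<in>{Suc q..r}. (real n - 1) * W s) \<le> W q" if q: "q \<in> {1..r}" for q
  proof -
    have "2 * (\<Sum>s\<in>{Suc q..r}. (real n - 1) * W s) = 2 * (real n - 1) * sum W {Suc q..r}"
      by (simp flip: sum_distrib_left)
    also have "\<dots> \<le> 2 * real n * sum W {Suc q..r}" using W_pos
      by (intro mult_right_mono sum_nonneg) (auto intro: less_imp_le)
    also have "\<dots> \<le> W q" using q by (intro W_tail) auto
    finally show ?thesis .
  qed
  \<comment> \<open>The sets of smaller scales are too short to cover \<open>P q\<close>.\<close>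
  have "\<exists>e. e \<in> P q - (\<Union>s\<in>{Suc q..r}. P s)" if q: "q \<in> {1..r}" for q
  proof (rule ccontr)
    assume "\<not> ?thesis"
    then have covered: "P q \<subseteq> (\<Union>s\<in>{Suc q..r}. P s)" by blast
    have sub: "P s \<subseteq> E" if "s \<in> {Suc q..r}" for s using PE[of s] that by auto
    then have "(\<Union>s\<in>{Suc q..r}. P s) \<subseteq> E" by (rule UN_least)
    with covered have "sum len (P q) \<le> sum len (\<Union>s\<in>{Suc q..r}. P s)" by (rule mono)
    also have "\<dots> \<le> (\<Sum>s\<in>{Suc q..r}. sum len (P s))"
      
    proof (rule sum_UNION_le)
      show "0 \<le> len x" if "s \<in> {Suc q..r}" "x \<in> P s" for s x
        using sub[OF that(1)] that(2) pos[of x] by auto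
    qed (use finite_subset[OF sub finite_edges] in auto)
    also have "\<dots> \<le> (\<Sum>s\<in>{Suc q..r}. (real n - 1) * W s)" using lenP_le by (intro sum_mono) auto
    finally show False using tail[OF q] lenP_ge[OF q] W_pos[of q] by linarith
  qed
  then obtain \<epsilon> where \<epsilon>: "\<And>q. q \<in> {1..r} \<Longrightarrow> \<epsilon> q \<in> P q - (\<Union>s\<in>{Suc q..r}. P s)"
    by metis
  \<comment> \<open>Of two chosen edges, the later one lies in its own set, which the earlier one avoids.\<close>
  have "\<epsilon> s \<noteq> \<epsilon> q" if "s \<in> {1..r}" "q \<in> {1..r}" "s < q" for s q
    using \<epsilon>[OF that(1)] \<epsilon>[OF that(2)] that by force
  then have inj: "inj_on \<epsilon> {1..r}" by (intro linorder_inj_onI) auto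
  have img: "\<epsilon> ` {1..r} = E"
  proof (rule card_seteq[OF finite_edges])
    show "\<epsilon> ` {1..r} \<subseteq> E" using \<epsilon> PE by blast
    show "card E \<le> card (\<epsilon> ` {1..r})" using card_image[OF inj] card_edges by simp
  qed
  have P_sub: "P q \<subseteq> \<epsilon> ` {q..r}" if q: "q \<in> {1..r}" for q
  proof
    fix e assume e: "e \<in> P q"
    then obtain s where s: "s \<in> {1..r}" "e = \<epsilon> s" using PE[OF q] img by blast
    have "\<not> s < q" using \<epsilon>[OF s(1)] s e q by auto
    then show "e \<in> \<epsilon> ` {q..r}" using s by auto
  qed
  \<comment> \<open>\<open>\<epsilon> s\<close> has at least the length of \<open>P s\<close> minus that of all later edges, hence at least \<open>W s / 2\<close>.\<close>
  have long: "(real n - 1) * W q < len (\<epsilon> s)" if s: "s \<in> {1..r}" and q: "q \<in> {1..r}" and "s < q" for s q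
  proof -
    have "sum len (P s) = len (\<epsilon> s) + sum len (P s - {\<epsilon> s})"
      using \<epsilon>[OF s] PE[OF s] finite_edges by (intro sum.remove) (auto intro: finite_subset)
    also have "sum len (P s - {\<epsilon> s}) \<le> sum len (\<epsilon> ` {Suc s..r})"
    proof (intro mono)
      show "P s - {\<epsilon> s} \<subseteq> \<epsilon> ` {Suc s..r}"
      proof -
        have "{s..r} = insert s {Suc s..r}" using s by auto
        then show ?thesis using P_sub[OF s] by auto
      qed
      show "\<epsilon> ` {Suc s..r} \<subseteq> E" using img s by auto
    qed
    also have "\<dots> = (\<Sum>k\<in>{Suc s..r}. len (\<epsilon> k))"
    proof -
      have "inj_on \<epsilon> {Suc s..r}" by (rule inj_on_subset[OF inj]) (use s in auto)
      then show ?thesis by (simp add: sum.reindex)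
    qed
    also have "\<dots> \<le> (\<Sum>k\<in>{Suc s..r}. (real n - 1) * W k)"
    proof (intro sum_mono)
      fix k assume "k \<in> {Suc s..r}"
      then have k: "k \<in> {1..r}" using s by auto
      have "sum len {\<epsilon> k} \<le> sum len (P k)" using \<epsilon>[OF k] PE[OF k] by (intro mono) auto
      then show "len (\<epsilon> k) \<le> (real n - 1) * W k" using lenP_le[OF k] by simp
    qed
    finally have "W s \<le> 2 * len (\<epsilon> s)" using tail[OF s] lenP_ge[OF s] by linarith
    moreover have "real B * W q \<le> W s"
      using W_antimono[of s "q - 1"] W_Suc[of "q - 1"] that by auto
    moreover have "(2 * real n + 1) * W q \<le> real B * W q"
      using base W_pos[of q] by (intro mult_right_mono) auto
    ultimately show ?thesis using W_pos[of q] by (simp add: algebra_simps)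
  qed
  have "leading len q (\<epsilon> ` {q<..r}) (\<epsilon> q) (l0 q) (l1 q)" if q: "q \<in> {1..r}" for q
  proof -
    have "\<epsilon> q \<notin> \<epsilon> ` {q<..r}"
      by (subst inj_on_image_mem_iff[OF inj]) (use q in auto)
    moreover have "P q \<subseteq> insert (\<epsilon> q) (\<epsilon> ` {q<..r})"
    proof -
      have "{q..r} = insert q {q<..r}" using q by auto
      then show ?thesis using P_sub[OF q] by simp
    qed
    moreover have "(real n - 1) * W q < len e" if e: "e \<in> E - \<epsilon> ` {q<..r} - {\<epsilon> q}" for e
    proof -
      obtain s where s: "s \<in> {1..r}" "e = \<epsilon> s" using e img by blast
      moreover have "\<not> q < s" "s \<noteq> q" using e s by auto
      ultimately show ?thesis using long[OF s(1) q] by simp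
    qed
    ultimately show ?thesis
      unfolding leading_def using l[OF q] sub[OF q] \<epsilon>[OF q] by (auto simp: g_def P_def)
  qed
  moreover have "bij_betw \<epsilon> {1..r} E" using inj img by (simp add: bij_betw_def)
  ultimately show ?thesis by blast
qed

lemma leadingD:
  assumes "leading len q U b l0 l1"
  shows "l0 \<in> A q" "l1 \<in> A q"
    "real l0 * W q + sum len (N q l0) = real l1 * W q + sum len (N q l1)"
    "\<And>l. l \<in> A q \<Longrightarrow> real l0 * W q + sum len (N q l0) \<le> real l * W q + sum len (N q l)"
    "N q l0 \<subseteq> N q l1" "b \<in> N q l1 - N q l0 - U" "N q l1 - N q l0 \<subseteq> insert b U"
    "\<And>e. e \<in> E - U - {b} \<Longrightarrow> (real n - 1) * W q < len e"
  using assms unfolding leading_def by blast+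

text \<open>
  A label that branched off before the long edge \<open>e\<close> would have a stem shorter than that of \<open>l0\<close> by
  at least the length of \<open>e\<close>, which exceeds \<open>(l - l0) W\<^sub>q\<close>; so \<open>l0\<close> would not attain the minimum.
\<close>

lemma first_long_edge:
  assumes q: "q \<in> {1..r}" and pos: "\<forall>e\<in>E. 0 < len e"
    and lead: "leading len q U b l0 l1"
    and l: "l \<in> A q"
  shows "N q l1 - U - {b} \<subseteq> N q l"
proof (rule subsetI, rule ccontr)
  note l0 = leadingD(1)[OF lead] and l1 = leadingD(2)[OF lead] and P = leadingD(7)[OF lead]
    and min = leadingD(4)[OF lead] and long = leadingD(8)[OF lead]
  fix e assume e: "e \<in> N q l1 - U - {b}" and el: "e \<notin> N q l"
  have e0: "e \<in> N q l0" using e P by auto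
  have sub: "N q l \<subseteq> N q l0" using chain[OF q l l0] e0 el by auto
  have eE: "e \<in> E - U - {b}" using e chain_edges[OF q l1] by auto
  have "sum len (insert e (N q l)) \<le> sum len (N q l0)"
    using e0 sub chain_edges[OF q l0] pos finite_edges
    by (intro sum_mono2) (auto intro: finite_subset less_imp_le)
  moreover have "sum len (insert e (N q l)) = len e + sum len (N q l)"
    using el chain_edges[OF q l] finite_edges by (intro sum.insert) (auto intro: finite_subset)
  moreover have "real l * W q - real l0 * W q \<le> (real n - 1) * W q"
  proof -
    have "l \<le> n" "1 \<le> l0" using labels[OF q] l l0 by auto
    then show ?thesis
      unfolding left_diff_distrib[symmetric] using W_pos[of q] by (intro mult_right_mono) auto
  qed
  ultimately show False using min[OF l] long[OF eE] by linarith
qed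

text \<open>
  Say that the stem of \<open>l1\<close> is contained in that of \<open>l1'\<close>.  If \<open>b\<close> and \<open>b'\<close> were different, then \<open>l0\<close>
  would branch off before \<open>b\<close>, which is a long edge for \<open>len'\<close> on the stem of \<open>l1'\<close>.  Once \<open>b = b'\<close>, the stems of \<open>l0\<close> and \<open>l0'\<close> agree outside \<open>U\<close>, and so do those of \<open>l1\<close> and
  \<open>l1'\<close>.  Each pair therefore attains the same minimum over terms that only involve edges in \<open>U\<close>,
  where the metrics coincide, and the length of \<open>b\<close> is the difference of the two minima.
\<close>

lemma leading_determined:
  assumes q: "q \<in> {1..r}" and pos: "\<forall>e\<in>E. 0 < len e" and pos': "\<forall>e\<in>E. 0 < len' e"
    and ld: "leading len q U b l0 l1" and ld': "leading len' q U b' l0' l1'"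
    and agree: "\<forall>e\<in>U. len e = len' e"
  shows "b = b' \<and> len b = len' b'"
proof -
  note lD = leadingD[OF ld] and lD' = leadingD[OF ld']
  have F: "N q l1 - U - {b} \<subseteq> N q a" if "a \<in> A q" for a
    using first_long_edge[OF q pos ld that] .
  have F': "N q l1' - U - {b'} \<subseteq> N q a" if "a \<in> A q" for a
    using first_long_edge[OF q pos' ld' that] .
  have b: "b = b'"
    using chain[OF q lD(2) lD'(2)] lD(6) lD'(6) F[OF lD'(1)] F'[OF lD(1)] by blast
  have N1: "N q l1 - U = N q l1' - U"
    using F[OF lD'(2)] F'[OF lD(2)] b lD(6) lD'(6) by blast
  have N0: "N q l0 - U = N q l1 - U - {b}" using lD(5,6,7) by blast
  have "N q l0' - U = N q l1' - U - {b'}" using lD'(5,6,7) by blast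
  then have N00: "N q l0 - U = N q l0' - U" using N0 N1 b by simp
  have fin: "finite (N q a)" if "a \<in> A q" for a
    using chain_edges[OF q that] finite_edges by (rule finite_subset)
  have part: "sum h (N q a) = sum h (N q a \<inter> U) + sum h (N q a - U)"
    if "a \<in> A q" for a and h :: "'e \<Rightarrow> real"
    using sum.Int_Diff[OF fin[OF that]] by simp
  have rem: "sum h (N q l1 - U) = h b + sum h (N q l0 - U)" for h :: "'e \<Rightarrow> real"
    unfolding N0 using fin[OF lD(2)] lD(6) by (intro sum.remove) auto
  have lenU: "sum len (G \<inter> U) = sum len' (G \<inter> U)" for G
    using agree by (intro sum.cong) auto
  have "real l0 * W q + sum len (N q l0 \<inter> U) = real l0' * W q + sum len (N q l0' \<inter> U)"
    using lD(4)[OF lD'(1)] lD'(4)[OF lD(1)]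
    by (simp add: part[OF lD(1)] part[OF lD'(1)] N00 lenU)
  moreover have "real l1 * W q + sum len (N q l1 \<inter> U) = real l1' * W q + sum len (N q l1' \<inter> U)"
    using lD(4)[OF lD'(2)] lD'(4)[OF lD(2)] lD(3) lD'(3)
    by (simp add: part[OF lD(2)] part[OF lD'(2)] N1 lenU)
  ultimately have "len b = len' b"
    using lD(3) lD'(3) rem[of len] rem[of len']
    by (simp add: part[OF lD(1)] part[OF lD'(1)] part[OF lD(2)] part[OF lD'(2)] lenU flip: N1 N00)
  then show ?thesis using b by simp
qed

theorem solution_unique:
  assumes sol: "solution len" and sol': "solution len'" and e: "e \<in> E"
  shows "len e = len' e"
proof -
  have pos: "\<forall>e\<in>E. 0 < len e" and pos': "\<forall>e\<in>E. 0 < len' e"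
    using sol sol' by (auto simp: solution_def)
  obtain \<epsilon> where bij: "bij_betw \<epsilon> {1..r} E"
    and lead: "\<And>q. q \<in> {1..r} \<Longrightarrow> \<exists>l0 l1. leading len q (\<epsilon> ` {q<..r}) (\<epsilon> q) l0 l1"
    using leading_edges[OF sol] by blast
  obtain \<epsilon>' where lead': "\<And>q. q \<in> {1..r} \<Longrightarrow> \<exists>l0 l1. leading len' q (\<epsilon>' ` {q<..r}) (\<epsilon>' q) l0 l1"
    using leading_edges[OF sol'] by blast
  have agree: "\<forall>s\<in>{q<..r}. \<epsilon> s = \<epsilon>' s \<and> len (\<epsilon> s) = len' (\<epsilon> s)" if "q \<le> r" for q
    using that
  proof (induction q rule: inc_induct)
    case base show ?case by simp
  next
    case (step k)
    define q where "q = Suc k"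
    then have q: "q \<in> {1..r}" using step by auto
    define U where "U = \<epsilon> ` {q<..r}"
    have U': "U = \<epsilon>' ` {q<..r}" unfolding U_def using step.IH by (auto simp: q_def image_iff)
    have agree: "\<forall>e\<in>U. len e = len' e" using step.IH by (auto simp: U_def q_def)
    obtain l0 l1 where ld: "leading len q U (\<epsilon> q) l0 l1" using lead[OF q] unfolding U_def by blast
    obtain l0' l1' where ld': "leading len' q U (\<epsilon>' q) l0' l1'" using lead'[OF q] unfolding U' by blast
    have "\<epsilon> q = \<epsilon>' q \<and> len (\<epsilon> q) = len' (\<epsilon>' q)" 
      using leading_determined[OF q pos pos' ld ld' agree] by blast
    then show ?case using step.IH by (auto simp: q_def) (metis Suc_lessI greaterThanAtMost_iff)+
  qed
  obtain s where s: "s \<in> {1..r}" "e = \<epsilon> s" using e bij by (auto simp: bij_betw_def)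
  then have "s \<in> {0<..r}" by simp
  then have "\<epsilon> s = \<epsilon>' s \<and> len (\<epsilon> s) = len' (\<epsilon> s)" by (rule bspec[OF agree[OF le0]])
  then show ?thesis using s by blast
qed

end

section \<open>The minimum of valuations on a hypersurface\<close>

locale valued_field = field R for R :: "'u ring" (structure) +
  fixes v :: "'u \<Rightarrow> real"
  assumes valuation: "real_valuation R v"

lemma (in valued_field) valuation_minus:
  assumes x: "x \<in> carrier R" "x \<noteq> \<zero>"
  shows "v (\<ominus> x) = v x"
proof -
  have mult: "v (a \<otimes> b) = v a + v b" if "a \<in> carrier R - {\<zero>}" "b \<in> carrier R - {\<zero>}" for a b
    using valuation that by (simp add: real_valuation_def)
  have m1: "\<ominus> \<one> \<in> carrier R - {\<zero>}" using add.inv_eq_1_iff by auto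
  have "v (\<one> \<otimes> \<one>) = v \<one> + v \<one>" by (intro mult) auto
  then have "v \<one> = 0" by simp
  moreover have "v (\<ominus> \<one> \<otimes> \<ominus> \<one>) = v (\<ominus> \<one>) + v (\<ominus> \<one>)" using m1 by (intro mult)
  moreover have "\<ominus> \<one> \<otimes> \<ominus> \<one> = \<one>" by (simp add: l_minus r_minus)
  ultimately have "v (\<ominus> \<one>) = 0" by simp
  moreover have "v (\<ominus> \<one> \<otimes> x) = v (\<ominus> \<one>) + v x" using m1 x by (intro mult) auto
  ultimately show ?thesis using x by (simp add: l_minus)
qed

lemma (in valued_field) valuation_finsum_gt:
  assumes "finite F"
    and "\<And>a. a \<in> F \<Longrightarrow> y a \<in> carrier R \<and> y a \<noteq> \<zero> \<and> C < v (y a)"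
    and "finsum R y F \<noteq> \<zero>"
  shows "C < v (finsum R y F)"
  using assms
proof (induction F rule: finite_induct)
  case (insert a F)
  have ya: "y a \<in> carrier R - {\<zero>}" "C < v (y a)" using insert.prems by auto
  have yF: "y \<in> F \<rightarrow> carrier R" using insert.prems by auto
  have sum: "finsum R y (insert a F) = y a \<oplus>\<^bsub>R\<^esub> finsum R y F"
    using insert.hyps ya yF by simp
  show ?case
  proof (cases "finsum R y F = \<zero>")
    case True
    then show ?thesis using ya by (simp add: sum)
  next
    case False
    then have "C < v (finsum R y F)" using insert by auto
    moreover have "finsum R y F \<in> carrier R - {\<zero>}" using False yF by simp
    then have "min (v (y a)) (v (finsum R y F)) \<le> v (y a \<oplus>\<^bsub>R\<^esub> finsum R y F)"
      using valuation ya(1) insert.prems(2) unfolding sum real_valuation_def by blast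
    ultimately show ?thesis using ya(2) by (simp add: sum)
  qed
qed simp

text \<open>
  If a single term had minimal valuation, then it would be the negative of the sum of the others,
  whose valuation is larger.
\<close>

lemma (in valued_field) min_attained_twice_if_finsum_zero:
  assumes A: "finite A" "A \<noteq> {}"
    and y: "\<And>a. a \<in> A \<Longrightarrow> y a \<in> carrier R \<and> y a \<noteq> \<zero>"
    and zero: "finsum R y A = \<zero>"
  shows "min_attained_twice A (\<lambda>a. v (y a))"
proof (rule ccontr)
  assume not: "\<not> ?thesis"
  define a where "a = arg_min_on (\<lambda>a. v (y a)) A"
  have a: "a \<in> A" unfolding a_def using A by (rule arg_min_if_finite(1))
  have min: "v (y a) \<le> v (y b)" if "b \<in> A" for b
    unfolding a_def using A that by (rule arg_min_least)
  have strict: "v (y a) < v (y b)" if "b \<in> A - {a}" for b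
  proof (rule ccontr)
    assume "\<not> ?thesis"
    then have "v (y a) = v (y b)" using min[of b] that by auto
    then show False using not a min that unfolding min_attained_twice_def by auto
  qed
  have yA: "y a \<in> carrier R" "y \<in> A - {a} \<rightarrow> carrier R" using a y by auto
  have "finsum R y (insert a (A - {a})) = y a \<oplus>\<^bsub>R\<^esub> finsum R y (A - {a})"
    using A yA by (intro finsum_insert) auto
  then have "y a \<oplus>\<^bsub>R\<^esub> finsum R y (A - {a}) = \<zero>" using zero a by (simp add: insert_absorb)
  then have rest: "finsum R y (A - {a}) = \<ominus> y a"
    using yA by (metis finsum_closed minus_equality minus_minus a_comm)
  then have "finsum R y (A - {a}) \<noteq> \<zero>" using a y by (metis minus_minus minus_zero)
  then have "v (y a) < v (finsum R y (A - {a}))"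
    using A y strict by (intro valuation_finsum_gt) auto
  then show False using rest valuation_minus a y by simp
qed

text \<open>
  Linear forms in two variables that vanish at a common point are proportional, and
  \<open>(x, y) \<mapsto> x b - y a\<close> is one that vanishes at \<open>(a, b)\<close>.  This turns numerator and denominator of
  an affine coordinate into minors.
\<close>

lemma (in valued_field) linear_form_eq_minor:
  assumes P: "a \<in> carrier R" "b \<in> carrier R" "(a, b) \<noteq> (\<zero>, \<zero>)"
    and form: "\<gamma> \<in> carrier R" "\<delta> \<in> carrier R" "(\<gamma>, \<delta>) \<noteq> (\<zero>, \<zero>)"
    and zero: "\<gamma> \<otimes> a \<oplus>\<^bsub>R\<^esub> \<delta> \<otimes> b = \<zero>"
  shows "\<exists>c\<in>carrier R. c \<noteq> \<zero> \<and>
    (\<forall>x\<in>carrier R. \<forall>y\<in>carrier R. \<gamma> \<otimes> x \<oplus>\<^bsub>R\<^esub> \<delta> \<otimes> y = c \<otimes> (x \<otimes> b \<ominus> y \<otimes> a))"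
proof (cases "b = \<zero>")
  case False
  define z where "z = inv b"
  have z: "z \<in> carrier R" "z \<noteq> \<zero>" "b \<otimes> z = \<one>" using False P field_Units unfolding z_def
    by auto
  have \<delta>: "\<delta> = \<ominus> (\<gamma> \<otimes> a \<otimes> z)"
  proof -
    have "\<delta> = \<delta> \<otimes> (b \<otimes> z)" using z form by simp
    also have "\<dots> = (\<gamma> \<otimes> a \<oplus>\<^bsub>R\<^esub> \<delta> \<otimes> b) \<otimes> z \<ominus> \<gamma> \<otimes> a \<otimes> z" using P form z(1) by algebra
    also have "\<dots> = \<ominus> (\<gamma> \<otimes> a \<otimes> z)" using zero P form z by (simp add: minus_eq)
    finally show ?thesis .
  qed
  have "\<gamma> \<noteq> \<zero>" using form(3) \<delta> P z by auto
  then have "\<gamma> \<otimes> z \<noteq> \<zero>" using z form integral by blast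
  moreover have "\<gamma> \<otimes> x \<oplus>\<^bsub>R\<^esub> \<delta> \<otimes> y = (\<gamma> \<otimes> z) \<otimes> (x \<otimes> b \<ominus> y \<otimes> a)"
    if "x \<in> carrier R" "y \<in> carrier R" for x y
  proof -
    have "\<gamma> \<otimes> x \<oplus>\<^bsub>R\<^esub> \<delta> \<otimes> y = \<gamma> \<otimes> x \<otimes> (b \<otimes> z) \<oplus>\<^bsub>R\<^esub> \<delta> \<otimes> y" using z form that by simp
    also have "\<dots> = (\<gamma> \<otimes> z) \<otimes> (x \<otimes> b \<ominus> y \<otimes> a)"
      unfolding \<delta> using P form z(1) that by algebra
    finally show ?thesis .
  qed
  ultimately show ?thesis using form z by blast
next
  case True
  then have a: "a \<noteq> \<zero>" using P by auto
  define z where "z = inv a"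
  have z: "z \<in> carrier R" "z \<noteq> \<zero>" "a \<otimes> z = \<one>" using a P field_Units unfolding z_def by auto
  have \<gamma>: "\<gamma> = \<zero>" using zero True a form P by (simp add: integral_iff)
  then have "\<ominus> (\<delta> \<otimes> z) \<noteq> \<zero>" using form z by (simp add: integral_iff)
  moreover have "\<gamma> \<otimes> x \<oplus>\<^bsub>R\<^esub> \<delta> \<otimes> y = \<ominus> (\<delta> \<otimes> z) \<otimes> (x \<otimes> b \<ominus> y \<otimes> a)"
    if "x \<in> carrier R" "y \<in> carrier R" for x y
  proof -
    have "\<gamma> \<otimes> x \<oplus>\<^bsub>R\<^esub> \<delta> \<otimes> y = \<delta> \<otimes> y \<otimes> (a \<otimes> z)" using z form that \<gamma> by simp
    also have "\<dots> = \<ominus> (\<delta> \<otimes> z) \<otimes> (x \<otimes> b \<ominus> y \<otimes> a)"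
      unfolding True using P form z(1) that by algebra
    finally show ?thesis .
  qed
  ultimately show ?thesis using form z by blast
qed

lemma (in valued_field) minor_swap:
  assumes "p a \<in> carrier R \<times> carrier R" "p b \<in> carrier R \<times> carrier R"
  shows "minor R p b a = \<ominus> minor R p a b"
proof -
  obtain x y x' y' where "p a = (x, y)" "p b = (x', y')" "{x, y, x', y'} \<subseteq> carrier R"
    using assms by auto
  then show ?thesis unfolding minor_def by simp algebra
qed

text \<open>
  Valuations only see the coordinates \<open>x l\<close> through minors, since \<open>x l = (d / c) [l j] / [l i]\<close> with
  constants \<open>c\<close> and \<open>d\<close>; the constants shift all terms by the same amount.
\<close>

lemma min_attained_twice_on_hypersurface:
  fixes \<phi> :: "'k::{alg_closed_field,field_char_0} fls \<Rightarrow> 'u"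
  assumes ext: "valued_extension L \<phi> v" and p: "marked_line L n p"
    and hyp: "hypersurface n B S i j q L \<phi> p"
    and S: "S \<subseteq> {1..n}" "card S \<ge> 3" "i \<in> S" "j \<in> S" "i \<noteq> j"
  shows "min_attained_twice (S - {i, j})
    (\<lambda>l. real l * real B ^ (n - 3 - q) + (v (minor L p l j) - v (minor L p l i)))"
proof -
  interpret valued_field L v
    using ext by (simp add: valued_extension_def valued_field_def valued_field_axioms_def)
  have hom: "\<phi> \<in> ring_hom ring_of_type_algebra L"
    and subdeg: "\<And>f. f \<noteq> 0 \<Longrightarrow> v (\<phi> f) = real_of_int (fls_subdegree f)"
    using ext by (auto simp: valued_extension_def)
  have mult: "v (a \<otimes>\<^bsub>L\<^esub> b) = v a + v b"
    if "a \<in> carrier L" "a \<noteq> \<zero>\<^bsub>L\<^esub>" "b \<in> carrier L" "b \<noteq> \<zero>\<^bsub>L\<^esub>" for a b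
    using valuation that by (simp add: real_valuation_def)
  have \<phi>_closed: "\<phi> f \<in> carrier L" for f
    using hom by (auto simp: ring_hom_def ring_of_type_algebra_def)
  have \<phi>_nonzero: "\<phi> f \<noteq> \<zero>\<^bsub>L\<^esub>" if "f \<noteq> 0" for f
  proof
    assume "\<phi> f = \<zero>\<^bsub>L\<^esub>"
    moreover have "\<phi> (f * inverse f) = \<phi> f \<otimes>\<^bsub>L\<^esub> \<phi> (inverse f)" "\<phi> 1 = \<one>\<^bsub>L\<^esub>"
      using hom by (auto simp: ring_hom_def ring_of_type_algebra_def)
    ultimately show False using that \<phi>_closed by simp
  qed
  have pc: "p a \<in> carrier L \<times> carrier L" if "a \<in> {1..n}" for a
    using p that by (simp add: marked_line_def)
  have minor_nz: "minor L p a b \<noteq> \<zero>\<^bsub>L\<^esub>" if "a \<in> {1..n}" "b \<in> {1..n}" "a \<noteq> b" for a b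
    using p that by (simp add: marked_line_def)
  have minor_closed: "minor L p a b \<in> carrier L" if "a \<in> {1..n}" "b \<in> {1..n}" for a b
    using pc[OF that(1)] pc[OF that(2)] by (auto simp: minor_def)
  have ij: "i \<in> {1..n}" "j \<in> {1..n}" using S by auto
  have p_nz: "p i \<noteq> (\<zero>\<^bsub>L\<^esub>, \<zero>\<^bsub>L\<^esub>)" "p j \<noteq> (\<zero>\<^bsub>L\<^esub>, \<zero>\<^bsub>L\<^esub>)"
    using minor_nz[OF ij S(5)] pc[OF ij(1)] pc[OF ij(2)] by (auto simp: minor_def minus_eq)
  obtain x where aff: "affine_coordinates L n p i j x"
    and zero: "(\<Oplus>\<^bsub>L\<^esub>l\<in>S - {i, j}. \<phi> (fls_X ^ (l * B ^ (n - 3 - q))) \<otimes>\<^bsub>L\<^esub> x l) = \<zero>\<^bsub>L\<^esub>"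
    using hyp by (auto simp: hypersurface_def)
  obtain \<alpha> \<beta> \<gamma> \<delta> where gl: "\<alpha> \<in> carrier L" "\<beta> \<in> carrier L" "\<gamma> \<in> carrier L" "\<delta> \<in> carrier L"
    and det: "\<alpha> \<otimes>\<^bsub>L\<^esub> \<delta> \<ominus>\<^bsub>L\<^esub> \<beta> \<otimes>\<^bsub>L\<^esub> \<gamma> \<noteq> \<zero>\<^bsub>L\<^esub>"
    and at_i: "\<gamma> \<otimes>\<^bsub>L\<^esub> fst (p i) \<oplus>\<^bsub>L\<^esub> \<delta> \<otimes>\<^bsub>L\<^esub> snd (p i) = \<zero>\<^bsub>L\<^esub>"
    and at_j: "\<alpha> \<otimes>\<^bsub>L\<^esub> fst (p j) \<oplus>\<^bsub>L\<^esub> \<beta> \<otimes>\<^bsub>L\<^esub> snd (p j) = \<zero>\<^bsub>L\<^esub>"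
    and x: "\<And>l. l \<in> {1..n} - {i} \<Longrightarrow> x l \<in> carrier L \<and>
           \<alpha> \<otimes>\<^bsub>L\<^esub> fst (p l) \<oplus>\<^bsub>L\<^esub> \<beta> \<otimes>\<^bsub>L\<^esub> snd (p l)
             = x l \<otimes>\<^bsub>L\<^esub> (\<gamma> \<otimes>\<^bsub>L\<^esub> fst (p l) \<oplus>\<^bsub>L\<^esub> \<delta> \<otimes>\<^bsub>L\<^esub> snd (p l))"
    using aff unfolding affine_coordinates_def by blast
  have "(\<gamma>, \<delta>) \<noteq> (\<zero>\<^bsub>L\<^esub>, \<zero>\<^bsub>L\<^esub>)" "(\<alpha>, \<beta>) \<noteq> (\<zero>\<^bsub>L\<^esub>, \<zero>\<^bsub>L\<^esub>)" using det gl by (auto simp: minus_eq)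
  then obtain c d where c: "c \<in> carrier L" "c \<noteq> \<zero>\<^bsub>L\<^esub>" and d: "d \<in> carrier L" "d \<noteq> \<zero>\<^bsub>L\<^esub>"
    and c_form: "\<forall>x\<in>carrier L. \<forall>y\<in>carrier L.
      \<gamma> \<otimes>\<^bsub>L\<^esub> x \<oplus>\<^bsub>L\<^esub> \<delta> \<otimes>\<^bsub>L\<^esub> y = c \<otimes>\<^bsub>L\<^esub> (x \<otimes>\<^bsub>L\<^esub> snd (p i) \<ominus>\<^bsub>L\<^esub> y \<otimes>\<^bsub>L\<^esub> fst (p i))"
    and d_form: "\<forall>x\<in>carrier L. \<forall>y\<in>carrier L.
      \<alpha> \<otimes>\<^bsub>L\<^esub> x \<oplus>\<^bsub>L\<^esub> \<beta> \<otimes>\<^bsub>L\<^esub> y = d \<otimes>\<^bsub>L\<^esub> (x \<otimes>\<^bsub>L\<^esub> snd (p j) \<ominus>\<^bsub>L\<^esub> y \<otimes>\<^bsub>L\<^esub> fst (p j))"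
    using linear_form_eq_minor[of "fst (p i)" "snd (p i)" \<gamma> \<delta>]
      linear_form_eq_minor[of "fst (p j)" "snd (p j)" \<alpha> \<beta>]
      gl at_i at_j p_nz pc[OF ij(1)] pc[OF ij(2)]
    by (auto simp: mem_Times_iff)
  have xl: "d \<otimes>\<^bsub>L\<^esub> minor L p l j = x l \<otimes>\<^bsub>L\<^esub> (c \<otimes>\<^bsub>L\<^esub> minor L p l i)" if "l \<in> {1..n} - {i}" for l
    using x[OF that] c_form d_form pc[of l] that by (auto simp: minor_def mem_Times_iff)
  \<comment> \<open>The marked points are distinct, so all minors involved are nonzero and valuations are additive.\<close>
  have x_nz: "x l \<noteq> \<zero>\<^bsub>L\<^esub>" and val: "v (x l) = (v (minor L p l j) - v (minor L p l i)) + (v d - v c)"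
    if "l \<in> S - {i, j}" for l
  proof -
    have l: "l \<in> {1..n}" "l \<noteq> i" "l \<noteq> j" using that S by auto
    note mj = minor_closed[OF l(1) ij(2)] minor_nz[OF l(1) ij(2) l(3)]
    note mi = minor_closed[OF l(1) ij(1)] minor_nz[OF l(1) ij(1) l(2)]
    have x': "x l \<in> carrier L" "d \<otimes>\<^bsub>L\<^esub> minor L p l j = x l \<otimes>\<^bsub>L\<^esub> (c \<otimes>\<^bsub>L\<^esub> minor L p l i)"
      using xl[of l] x[of l] l by auto
    have lhs_nz: "d \<otimes>\<^bsub>L\<^esub> minor L p l j \<noteq> \<zero>\<^bsub>L\<^esub>" using d mj integral by blast
    have cm: "c \<otimes>\<^bsub>L\<^esub> minor L p l i \<in> carrier L" "c \<otimes>\<^bsub>L\<^esub> minor L p l i \<noteq> \<zero>\<^bsub>L\<^esub>"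
      using c mi integral by auto
    show "x l \<noteq> \<zero>\<^bsub>L\<^esub>" using lhs_nz x'(2) cm by auto
    then have "v (x l \<otimes>\<^bsub>L\<^esub> (c \<otimes>\<^bsub>L\<^esub> minor L p l i)) = v (x l) + (v c + v (minor L p l i))"
      using mult[OF x'(1) _ cm] mult[OF c mi] by simp
    moreover have "v (d \<otimes>\<^bsub>L\<^esub> minor L p l j) = v d + v (minor L p l j)" by (rule mult[OF d mj])
    ultimately show "v (x l) = (v (minor L p l j) - v (minor L p l i)) + (v d - v c)"
      using x'(2) by simp
  qed
  define y where "y l = \<phi> (fls_X ^ (l * B ^ (n - 3 - q))) \<otimes>\<^bsub>L\<^esub> x l" for l
  have x_closed: "x l \<in> carrier L" if "l \<in> S - {i, j}" for l using x[of l] that S by auto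
  have y: "y l \<in> carrier L \<and> y l \<noteq> \<zero>\<^bsub>L\<^esub>" if "l \<in> S - {i, j}" for l
    unfolding y_def using x_closed[OF that] x_nz[OF that] \<phi>_closed
    by (simp add: integral_iff \<phi>_nonzero)
  have vy: "v (y l) = (real l * real B ^ (n - 3 - q)
      + (v (minor L p l j) - v (minor L p l i))) + (v d - v c)"
    if "l \<in> S - {i, j}" for l
    unfolding y_def using mult[OF \<phi>_closed \<phi>_nonzero x_closed[OF that] x_nz[OF that]]
    by (simp add: subdeg val[OF that] fls_subdegree_pow)
  have fin: "finite S" using S(1) finite_subset by blast
  have "card (S - {i, j}) > 0" using card_Diff_subset[of "{i, j}" S] S fin by auto
  then have "finite (S - {i, j})" "S - {i, j} \<noteq> {}" using fin by (auto simp: card_gt_0_iff)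
  then have "min_attained_twice (S - {i, j}) (\<lambda>l. v (y l))"
    using y zero unfolding y_def[symmetric] by (intro min_attained_twice_if_finsum_zero) auto
  moreover have "min_attained_twice (S - {i, j}) (\<lambda>l. v (y l)) \<longleftrightarrow> min_attained_twice (S - {i, j})
    (\<lambda>l. real l * real B ^ (n - 3 - q) + (v (minor L p l j) - v (minor L p l i)))"
    by (rule min_attained_twice_shift[where C = "v d - v c"]) (rule vy)
  ultimately show ?thesis by blast
qed

section \<open>Paths, stems and distances in a tree\<close>

definition path_edges :: "('a \<times> 'a) list \<Rightarrow> 'a set set" where
  "path_edges p = (\<lambda>(u, v). {u, v}) ` set p"

definition path_length :: "('a set \<Rightarrow> real) \<Rightarrow> ('a \<times> 'a) list \<Rightarrow> real" where
  "path_length len p = sum_list (map (\<lambda>(u, v). len {u, v}) p)"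

lemma path_length_append: "path_length len (p @ q) = path_length len p + path_length len q"
  by (simp add: path_length_def)

lemma path_length_rev_path: "path_length len (rev_path p) = path_length len p"
  by (induction p) (auto simp: path_length_def insert_commute split: prod.splits)

lemma path_edges_mono: "prefix p q \<Longrightarrow> path_edges p \<subseteq> path_edges q"
  unfolding path_edges_def by (intro image_mono set_mono_prefix)

locale unique_path_tree = pair_graph G for G :: "'a pair_pre_digraph" +
  assumes unique_apath: "u \<in> pverts G \<Longrightarrow> v \<in> pverts G \<Longrightarrow> \<exists>!p. apath u p v"
begin

definition tree_path :: "'a \<Rightarrow> 'a \<Rightarrow> ('a \<times> 'a) list" where
  "tree_path u v = (THE p. apath u p v)"

lemma apath_tree_path: "u \<in> pverts G \<Longrightarrow> v \<in> pverts G \<Longrightarrow> apath u (tree_path u v) v"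
  unfolding tree_path_def by (rule theI') (rule unique_apath)

lemma apath_ends_in_verts: "apath u p v \<Longrightarrow> u \<in> pverts G \<and> v \<in> pverts G"
  using awalk_hd_in_verts awalk_last_in_verts awalkI_apath by blast

lemma tree_path_eqI: 
  assumes "apath u p v" shows "tree_path u v = p"
  unfolding tree_path_def using assms apath_ends_in_verts[OF assms] unique_apath
  by (intro the1_equality) blast+

lemma tree_path_swap:
  assumes "u \<in> pverts G" "v \<in> pverts G"
  shows "tree_path v u = rev_path (tree_path u v)"
  using apath_tree_path[OF assms] by (intro tree_path_eqI) simp

lemma path_edges_subset: "apath u p v \<Longrightarrow> path_edges p \<subseteq> edges G"
  by (fastforce simp: path_edges_def edges_def apath_def awalk_def)

lemma path_edges_verts: "apath u p v \<Longrightarrow> e \<in> path_edges p \<Longrightarrow> e \<subseteq> set (pawalk_verts u p)"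
  using awalk_verts_arc1[of _ p u] awalk_verts_arc2[of u p v] awalkI_apath[of u p v]
  by (fastforce simp: path_edges_def)

text \<open>A path meets no vertex twice, so it runs through every undirected edge at most once.\<close>

lemma path_length_eq_sum:
  assumes "apath u p v"
  shows "path_length len p = sum len (path_edges p)"
  using assms
proof (induction p arbitrary: u)
  case Nil
  then show ?case by (simp add: path_length_def path_edges_def)
next
  case (Cons a p)
  obtain x where a: "a = (u, x)" and p: "apath x p v" and u: "u \<notin> set (pawalk_verts x p)"
    using Cons.prems by (cases a) (auto simp: apath_Cons_iff)
  have "{u, x} \<notin> path_edges p" using path_edges_verts[OF p] u by blast
  then show ?case using Cons.IH[OF p] by (simp add: a path_length_def path_edges_def)
qed

text \<open>
  After their common beginning \<open>c\<close>, the paths from \<open>u\<close> to \<open>v\<close> and to \<open>w\<close> never meet again: by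
  uniqueness of paths, they would coincide up to the meeting point, and \<open>c\<close> could be extended.
  Hence the two ends form a path from \<open>v\<close> to \<open>w\<close>.
\<close>

lemma tree_path_tripod:
  assumes V: "u \<in> pverts G" "v \<in> pverts G" "w \<in> pverts G"
    and c: "c = longest_common_prefix (tree_path u v) (tree_path u w)"
    and p: "tree_path u v = c @ p" and q: "tree_path u w = c @ q"
  shows "tree_path v w = rev_path p @ q"
proof -
  define z where "z = last (pawalk_verts u c)"
  have P: "apath z p v" and Q: "apath z q w"
    using apath_tree_path[OF V(1,2)] apath_tree_path[OF V(1,3)] unfolding p q z_def
    by (auto simp: apath_append_iff)
  have disj: "set (pawalk_verts z p) \<inter> set (tl (pawalk_verts z q)) = {}"
  proof (rule ccontr)
    assume "\<not> ?thesis"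
    then obtain y where y: "y \<in> set (pawalk_verts z p)" "y \<in> set (tl (pawalk_verts z q))" by blast
    have dist: "distinct (pawalk_verts z q)" and hd: "hd (pawalk_verts z q) = z"
      using Q by (auto simp: apath_def)
    have "y \<noteq> z" using y(2) dist hd by (cases "pawalk_verts z q") auto
    have y': "y \<in> set (pawalk_verts z q)" using y(2) by (metis list.set_sel(2) tl_Nil)
    obtain p1 p2 where p12: "p = p1 @ p2" "awalk z p1 y" "awalk y p2 v"
      using awalk_decomp[OF awalkI_apath[OF P] y(1)] by blast
    obtain q1 q2 where q12: "q = q1 @ q2" "awalk z q1 y" "awalk y q2 w"
      using awalk_decomp[OF awalkI_apath[OF Q] y'] by blast
    have "apath z p1 y"
      using P p12(2) awlast_of_awalk[OF p12(2)] unfolding p12(1) by (simp add: apath_append_iff)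
    moreover have "apath z q1 y"
      using Q q12(2) awlast_of_awalk[OF q12(2)] unfolding q12(1) by (simp add: apath_append_iff)
    ultimately have "p1 = q1" using tree_path_eqI by blast
    then have "prefix (c @ p1) (tree_path u v)" "prefix (c @ p1) (tree_path u w)"
      by (simp_all add: p q p12(1) q12(1))
    then have "prefix (c @ p1) c"
      by (subst (2) c) (rule longest_common_prefix_max_prefix)
    then have "p1 = []" by simp
    then show False using p12(2) \<open>y \<noteq> z\<close> by (simp add: awalk_Nil_iff)
  qed
  have R: "apath v (rev_path p) z" using P by simp
  have verts: "pawalk_verts v (rev_path p) = rev (pawalk_verts z p)"
    using awalk_verts_rev_path[OF awalkI_apath[OF P]] .
  have "last (pawalk_verts v (rev_path p)) = z" using R by (auto simp: apath_def)
  then have "apath v (rev_path p @ q) w"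
    using R Q disj by (simp add: apath_append_iff verts)
  then show ?thesis by (rule tree_path_eqI)
qed

text \<open>
  The edges on the path from \<open>u\<close> to \<open>v\<close> that lie before the point where \<open>w\<close> branches off.  Being
  initial segments of one path, the stems for varying \<open>w\<close> form a chain.
\<close>

definition stem :: "'a \<Rightarrow> 'a \<Rightarrow> 'a \<Rightarrow> 'a set set" where
  "stem u v w = path_edges (longest_common_prefix (tree_path u v) (tree_path u w))"

lemma stem_subset:
  assumes "u \<in> pverts G" "v \<in> pverts G"
  shows "stem u v w \<subseteq> edges G"
  unfolding stem_def
  using path_edges_mono[OF longest_common_prefix_prefix1] path_edges_subset[OF apath_tree_path[OF assms]]
  by blast

lemma stem_chain: "stem u v w \<subseteq> stem u v w' \<or> stem u v w' \<subseteq> stem u v w"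
proof -
  let ?c = "\<lambda>w. longest_common_prefix (tree_path u v) (tree_path u w)"
  have "prefix (?c w) (?c w') \<or> prefix (?c w') (?c w)"
    using longest_common_prefix_prefix1 prefix_same_cases by blast
  then show ?thesis unfolding stem_def using path_edges_mono by blast
qed

text \<open>
  In the tripod spanned by \<open>u\<close>, \<open>v\<close> and \<open>w\<close>, the leg at \<open>w\<close> cancels from the difference of the
  distances, which leaves the leg at \<open>u\<close>, that is the stem, minus the leg at \<open>v\<close>.
\<close>

lemma path_length_difference:
  assumes V: "u \<in> pverts G" "v \<in> pverts G" "w \<in> pverts G"
  shows "path_length len (tree_path w u) - path_length len (tree_path w v)
    = 2 * sum len (stem u v w) - path_length len (tree_path u v)"
proof -
  define c where "c = longest_common_prefix (tree_path u v) (tree_path u w)"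
  obtain p where p: "tree_path u v = c @ p"
    unfolding c_def using longest_common_prefix_prefix1 by (metis prefixE)
  obtain q where q: "tree_path u w = c @ q"
    unfolding c_def using longest_common_prefix_prefix2 by (metis prefixE)
  have "tree_path v w = rev_path p @ q" using V c_def p q by (rule tree_path_tripod)
  moreover have "apath u c (last (pawalk_verts u c))"
    using apath_tree_path[OF V(1,2)] unfolding p by (auto simp: apath_append_iff)
  then have "path_length len c = sum len (stem u v w)"
    unfolding stem_def c_def[symmetric] by (rule path_length_eq_sum)
  ultimately show ?thesis
    unfolding tree_path_swap[OF V(1,3)] tree_path_swap[OF V(2,3)] path_length_rev_path
    by (simp add: p q path_length_append path_length_rev_path)
qed

lemma finite_edges: "finite (edges G)"
proof -
  have "edges G = (\<lambda>(u, v). {u, v}) ` parcs G" by (auto simp: edges_def)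
  then show ?thesis using pair_finite_arcs by simp
qed

end

section \<open>Isomorphism of metric trees\<close>

lemma unique_path_tree_if_undirected_tree:
  assumes "undirected_tree T" shows "unique_path_tree T"
proof -
  interpret pair_graph T using assms by (simp add: undirected_tree_def)
  show ?thesis using assms by unfold_locales (auto simp: undirected_tree_def)
qed

lemma unique_path_tree_if_stable: "\<tau> \<in> stable_trees n \<Longrightarrow> unique_path_tree (graph_of \<tau>)"
  by (simp add: stable_trees_def unique_path_tree_if_undirected_tree)

lemma leg_in_pverts: "\<tau> \<in> stable_trees n \<Longrightarrow> a \<in> {1..n} \<Longrightarrow> leg \<tau> a \<in> pverts (graph_of \<tau>)"
  by (auto simp: stable_trees_def)

lemma leg_dist_eq:
  assumes "\<tau> \<in> stable_trees n"
  shows "leg_dist (\<tau>, len) a b =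
    path_length len (unique_path_tree.tree_path (graph_of \<tau>) (leg \<tau> a) (leg \<tau> b))"
  using unique_path_tree.tree_path_def[OF unique_path_tree_if_stable[OF assms]]
  by (simp add: leg_dist_def path_length_def)

lemma edges_eq_image: "edges T = (\<lambda>(u, v). {u, v}) ` parcs T"
  by (auto simp: edges_def)

lemma edge_subset_pverts:
  assumes "\<tau> \<in> stable_trees n" "e \<in> edges (graph_of \<tau>)"
  shows "e \<subseteq> pverts (graph_of \<tau>)"
proof -
  interpret unique_path_tree "graph_of \<tau>" using assms(1) by (rule unique_path_tree_if_stable)
  show ?thesis using assms(2) by (auto simp: edges_def dest: in_arcsD1 in_arcsD2)
qed

lemma tree_iso_arc:
  assumes "tree_iso n f \<tau> \<tau>'" "\<tau> \<in> stable_trees n" "(u, v) \<in> parcs (graph_of \<tau>)"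
  shows "(f u, f v) \<in> parcs (graph_of \<tau>')"
proof -
  interpret unique_path_tree "graph_of \<tau>" using assms(2) by (rule unique_path_tree_if_stable)
  show ?thesis using assms in_arcsD1 in_arcsD2 unfolding tree_iso_def by blast
qed

lemma tree_iso_edges:
  assumes iso: "tree_iso n f \<tau> \<tau>'" and st: "\<tau> \<in> stable_trees n" "\<tau>' \<in> stable_trees n"
  shows "edges (graph_of \<tau>') = (`) f ` edges (graph_of \<tau>)"
proof (intro equalityI subsetI)
  fix e assume "e \<in> (`) f ` edges (graph_of \<tau>)"
  then show "e \<in> edges (graph_of \<tau>')"
    using tree_iso_arc[OF iso st(1)] by (force simp: edges_def)
next
  interpret T': unique_path_tree "graph_of \<tau>'" using st(2) by (rule unique_path_tree_if_stable)
  fix e assume "e \<in> edges (graph_of \<tau>')"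
  then obtain x y where e: "e = {x, y}" "(x, y) \<in> parcs (graph_of \<tau>')" by (auto simp: edges_def)
  then have "x \<in> pverts (graph_of \<tau>')" "y \<in> pverts (graph_of \<tau>')"
    using T'.in_arcsD1 T'.in_arcsD2 by auto
  then obtain u v where uv: "u \<in> pverts (graph_of \<tau>)" "v \<in> pverts (graph_of \<tau>)" "x = f u" "y = f v"
    using iso unfolding tree_iso_def bij_betw_def by blast
  then have "(u, v) \<in> parcs (graph_of \<tau>)" using iso e by (simp add: tree_iso_def)
  then have "{u, v} \<in> edges (graph_of \<tau>)" by (auto simp: edges_def)
  moreover have "e = f ` {u, v}" using e uv by simp
  ultimately show "e \<in> (`) f ` edges (graph_of \<tau>)" by blast
qed

lemma tree_iso_card_edges:
  assumes iso: "tree_iso n f \<tau> \<tau>'" and st: "\<tau> \<in> stable_trees n" "\<tau>' \<in> stable_trees n"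
  shows "card (edges (graph_of \<tau>')) = card (edges (graph_of \<tau>))"
  unfolding tree_iso_edges[OF assms]
proof (rule card_image)
  have "inj_on ((`) f) (Pow (pverts (graph_of \<tau>)))"
    using iso by (intro inj_on_image_Pow) (simp add: tree_iso_def bij_betw_def)
  then show "inj_on ((`) f) (edges (graph_of \<tau>))"
    by (rule inj_on_subset) (use edge_subset_pverts[OF st(1)] in auto)
qed

text \<open>
  Distances are defined through paths, so their invariance under isomorphisms rests on the fact
  that isomorphisms map paths to paths.
\<close>

lemma tree_iso_apath:
  assumes iso: "tree_iso n f \<tau> \<tau>'" and st: "\<tau> \<in> stable_trees n" "\<tau>' \<in> stable_trees n"
    and p: "pre_digraph.apath (with_proj (graph_of \<tau>)) u p v"
  shows "pre_digraph.apath (with_proj (graph_of \<tau>')) (f u) (map (map_prod f f) p) (f v)"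
proof -
  interpret T: unique_path_tree "graph_of \<tau>" using st(1) by (rule unique_path_tree_if_stable)
  interpret T': unique_path_tree "graph_of \<tau>'" using st(2) by (rule unique_path_tree_if_stable)
  have verts: "pawalk_verts (f u) (map (map_prod f f) p) = map f (pawalk_verts u p)" for u p
    by (induction p arbitrary: u) (auto simp: map_prod_def split: prod.splits)
  have inj: "inj_on f (pverts (graph_of \<tau>))" and into: "f ` pverts (graph_of \<tau>) = pverts (graph_of \<tau>')"
    using iso by (auto simp: tree_iso_def bij_betw_def)
  show ?thesis using p
  proof (induction p arbitrary: u)
    case Nil
    then show ?case using into by (auto simp: T.apath_Nil_iff T'.apath_Nil_iff)
  next
    case (Cons a p)
    obtain w where a: "a = (u, w)" "(u, w) \<in> parcs (graph_of \<tau>)"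
      and p: "T.apath w p v" and u: "u \<notin> set (pawalk_verts w p)"
      using Cons.prems by (cases a) (auto simp: T.apath_Cons_iff)
    have "set (pawalk_verts w p) \<subseteq> pverts (graph_of \<tau>)" using p by (auto simp: T.apath_def)
    then have "f u \<notin> f ` set (pawalk_verts w p)"
      using inj u T.in_arcsD1[OF a(2)] by (auto simp: inj_on_def)
    then show ?case
      using Cons.IH[OF p] tree_iso_arc[OF iso st(1) a(2)] by (simp add: a T'.apath_Cons_iff verts)
  qed
qed

lemma leg_dist_invariant:
  assumes rel: "((\<tau>, len), (\<tau>', len')) \<in> metric_rel n" and ab: "a \<in> {1..n}" "b \<in> {1..n}"
  shows "leg_dist (\<tau>', len') a b = leg_dist (\<tau>, len) a b"
proof -
  obtain f where st: "\<tau> \<in> stable_trees n" "\<tau>' \<in> stable_trees n" and iso: "tree_iso n f \<tau> \<tau>'"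
    and len: "\<forall>e\<in>edges (graph_of \<tau>). len' (f ` e) = len e"
    using rel by (auto simp: metric_rel_def metric_trees_def)
  interpret T: unique_path_tree "graph_of \<tau>" using st(1) by (rule unique_path_tree_if_stable)
  interpret T': unique_path_tree "graph_of \<tau>'" using st(2) by (rule unique_path_tree_if_stable)
  define p where "p = T.tree_path (leg \<tau> a) (leg \<tau> b)"
  have p: "T.apath (leg \<tau> a) p (leg \<tau> b)"
    unfolding p_def using ab leg_in_pverts[OF st(1)] by (intro T.apath_tree_path) auto
  have legs: "leg \<tau>' a = f (leg \<tau> a)" "leg \<tau>' b = f (leg \<tau> b)"
    using iso ab by (auto simp: tree_iso_def)
  have "T'.tree_path (leg \<tau>' a) (leg \<tau>' b) = map (map_prod f f) p"
    unfolding legs by (intro T'.tree_path_eqI tree_iso_apath[OF iso st p])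
  moreover have "path_length len' (map (map_prod f f) p) = path_length len p"
    unfolding path_length_def map_map
  proof (intro arg_cong[where f = sum_list] map_cong refl)
    fix x assume "x \<in> set p"
    moreover have "set p \<subseteq> parcs (graph_of \<tau>)" using p by (auto simp: T.apath_def)
    ultimately have "(\<lambda>(u, v). {u, v}) x \<in> edges (graph_of \<tau>)" by (auto simp: edges_eq_image)
    then show "((\<lambda>(u, v). len' {u, v}) \<circ> map_prod f f) x = (case x of (u, v) \<Rightarrow> len {u, v})"
      using len by (auto split: prod.splits)
  qed
  ultimately show ?thesis by (simp add: leg_dist_eq[OF st(1)] leg_dist_eq[OF st(2)] p_def)
qed

lemma tree_iso_inverse:
  assumes iso: "tree_iso n f \<tau> \<tau>'" and st: "\<tau> \<in> stable_trees n"
  shows "tree_iso n (inv_into (pverts (graph_of \<tau>)) f) \<tau>' \<tau>"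
proof -
  let ?V = "pverts (graph_of \<tau>)" and ?V' = "pverts (graph_of \<tau>')"
  let ?g = "inv_into ?V f"
  have bij: "bij_betw f ?V ?V'" using iso by (simp add: tree_iso_def)
  have fg: "f (?g x) = x" "?g x \<in> ?V" if "x \<in> ?V'" for x
    using that bij by (auto simp: bij_betw_def f_inv_into_f inv_into_into)
  have gf: "?g (f u) = u" if "u \<in> ?V" for u
    using that bij by (simp add: bij_betw_def)
  show ?thesis
    unfolding tree_iso_def
  proof (intro conjI ballI)
    show "bij_betw ?g ?V' ?V" using bij by (rule bij_betw_inv_into)
    fix x y assume "x \<in> ?V'" "y \<in> ?V'"
    then show "(x, y) \<in> parcs (graph_of \<tau>') \<longleftrightarrow> (?g x, ?g y) \<in> parcs (graph_of \<tau>)"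
      using iso fg[of x] fg[of y] by (auto simp: tree_iso_def)
  next
    fix a assume "a \<in> {1..n}"
    then show "leg \<tau> a = ?g (leg \<tau>' a)"
      using iso gf[OF leg_in_pverts[OF st]] by (simp add: tree_iso_def)
  qed
qed

lemma tree_iso_compose:
  assumes "tree_iso n f \<tau> \<tau>'" "tree_iso n g \<tau>' \<tau>''"
  shows "tree_iso n (g \<circ> f) \<tau> \<tau>''"
proof -
  have "f u \<in> pverts (graph_of \<tau>')" if "u \<in> pverts (graph_of \<tau>)" for u
    using assms(1) that by (auto simp: tree_iso_def bij_betw_def)
  then show ?thesis
    using assms by (auto simp: tree_iso_def intro: bij_betw_trans)
qed

lemma tree_iso_id: "tree_iso n id \<tau> \<tau>"
  by (simp add: tree_iso_def)

lemma metric_relI: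
  assumes "(\<tau>, len) \<in> metric_trees n" "(\<tau>', len') \<in> metric_trees n" "tree_iso n f \<tau> \<tau>'"
    and "\<And>e. e \<in> edges (graph_of \<tau>) \<Longrightarrow> len' (f ` e) = len e"
  shows "((\<tau>, len), (\<tau>', len')) \<in> metric_rel n"
  using assms by (auto simp: metric_rel_def)

lemma equiv_metric_rel: "equiv (metric_trees n) (metric_rel n)"
proof (rule equivI)
  show "metric_rel n \<subseteq> metric_trees n \<times> metric_trees n" by (auto simp: metric_rel_def)
  show "refl_on (metric_trees n) (metric_rel n)"
    by (rule refl_onI) (auto intro!: metric_relI[where f = id] tree_iso_id)
  show "sym (metric_rel n)"
  proof (rule symI, clarify)
    fix \<tau> len \<tau>' len' assume rel: "((\<tau>, len), (\<tau>', len')) \<in> metric_rel n"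
    then obtain f where T: "(\<tau>, len) \<in> metric_trees n" "(\<tau>', len') \<in> metric_trees n"
      and iso: "tree_iso n f \<tau> \<tau>'" and len: "\<forall>e\<in>edges (graph_of \<tau>). len' (f ` e) = len e"
      by (auto simp: metric_rel_def)
    have st: "\<tau> \<in> stable_trees n" "\<tau>' \<in> stable_trees n" using T by (auto simp: metric_trees_def)
    let ?g = "inv_into (pverts (graph_of \<tau>)) f"
    have "len (?g ` e') = len' e'" if "e' \<in> edges (graph_of \<tau>')" for e'
    proof -
      obtain e where e: "e \<in> edges (graph_of \<tau>)" "e' = f ` e"
        using \<open>e' \<in> _\<close> tree_iso_edges[OF iso st] by auto
      have "inj_on f (pverts (graph_of \<tau>))" using iso by (simp add: tree_iso_def bij_betw_def)
      then have "?g ` e' = e"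
        unfolding e(2) using edge_subset_pverts[OF st(1) e(1)] by (rule inv_into_image_cancel)
      then show ?thesis using len e by simp
    qed
    then show "((\<tau>', len'), (\<tau>, len)) \<in> metric_rel n"
      using T by (intro metric_relI[OF _ _ tree_iso_inverse[OF iso st(1)]])
  qed
  show "trans (metric_rel n)"
  proof (rule transI, clarify)
    fix \<tau> len \<tau>' len' \<tau>'' len''
    assume "((\<tau>, len), (\<tau>', len')) \<in> metric_rel n" "((\<tau>', len'), (\<tau>'', len'')) \<in> metric_rel n"
    then obtain f g where T: "(\<tau>, len) \<in> metric_trees n" "(\<tau>', len') \<in> metric_trees n"
        "(\<tau>'', len'') \<in> metric_trees n"
      and iso: "tree_iso n f \<tau> \<tau>'" "tree_iso n g \<tau>' \<tau>''"
      and len: "\<forall>e\<in>edges (graph_of \<tau>). len' (f ` e) = len e" "\<forall>e\<in>edges (graph_of \<tau>'). len'' (g ` e) = len' e"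
      by (auto simp: metric_rel_def)
    have st: "\<tau> \<in> stable_trees n" "\<tau>' \<in> stable_trees n" using T by (auto simp: metric_trees_def)
    show "((\<tau>, len), (\<tau>'', len'')) \<in> metric_rel n"
    proof (rule metric_relI[OF T(1,3) tree_iso_compose[OF iso]])
      fix e assume e: "e \<in> edges (graph_of \<tau>)"
      then have "f ` e \<in> edges (graph_of \<tau>')" using tree_iso_edges[OF iso(1) st] by auto
      then show "len'' ((g \<circ> f) ` e) = len e" using len e by (simp flip: image_image)
    qed
  qed
qed

text \<open>
  As the points are the classes of an equivalence relation, every metric tree in a class may stand
  for it.
\<close>

lemma M0n_tropD:
  assumes "\<Gamma> \<in> M0n_trop n" "T \<in> \<Gamma>"
  shows "\<Gamma> = metric_rel n `` {T}" "T \<in> metric_trees n"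
proof -
  obtain T0 where "\<Gamma> = metric_rel n `` {T0}"
    using assms(1) unfolding M0n_trop_def by (rule quotientE)
  then have rel: "(T0, T) \<in> metric_rel n" using assms(2) by simp
  then show "T \<in> metric_trees n" using equiv_type[OF equiv_metric_rel] by blast
  show "\<Gamma> = metric_rel n `` {T}"
    using \<open>\<Gamma> = _\<close> equiv_class_eq[OF equiv_metric_rel rel] by simp
qed

section \<open>The tropical hypersurfaces\<close>

text \<open>
  The vector of minors of a point determines the distances only modulo the action of the torus, and
  only for pairs \<open>a < b\<close>.  The first ambiguity contributes the constant \<open>c i - c j\<close> to every term of the
  minimum; the second is harmless because minors are antisymmetric and the valuation ignores signs.
\<close>

lemma Trop_hypersurface_min:
  fixes Z :: "('k::{alg_closed_field,field_char_0}, 'u) subscheme"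
  assumes \<Gamma>: "\<Gamma> \<in> Trop n Z" and Z: "Z = hypersurface n B S i j q"
    and T: "(\<tau>, len) \<in> \<Gamma>"
    and S: "S \<subseteq> {1..n}" "card S \<ge> 3" "i \<in> S" "j \<in> S" "i \<noteq> j"
  shows "min_attained_twice (S - {i, j}) (\<lambda>l. real l * real B ^ (n - 3 - q)
    + sum len (unique_path_tree.stem (graph_of \<tau>) (leg \<tau> i) (leg \<tau> j) (leg \<tau> l)))"
proof -
  obtain T0 and L :: "'u ring" and \<phi> :: "'k fls \<Rightarrow> 'u" and v p where
    M: "\<Gamma> \<in> M0n_trop n" and T0: "T0 \<in> \<Gamma>"
    and ext: "valued_extension L \<phi> v" and p: "marked_line L n p" and Zp: "hypersurface n B S i j q L \<phi> p"
    and lin: "lineality_equiv n (\<lambda>a b. v (minor L p a b)) (\<lambda>a b. - leg_dist T0 a b / 2)"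
    using \<Gamma> unfolding Trop_def Z by blast
  interpret L: valued_field L v
    using ext by (simp add: valued_extension_def valued_field_def valued_field_axioms_def)
  have st: "\<tau> \<in> stable_trees n" using M0n_tropD(2)[OF M T] by (simp add: metric_trees_def)
  interpret G: unique_path_tree "graph_of \<tau>" using st by (rule unique_path_tree_if_stable)
  note legs = leg_in_pverts[OF st]
  define d where "d = leg_dist (\<tau>, len)"
  have d0: "leg_dist T0 a b = d a b" if "a \<in> {1..n}" "b \<in> {1..n}" for a b
  proof -
    have "((\<tau>, len), T0) \<in> metric_rel n" using M0n_tropD(1)[OF M T] T0 by simp
    then show ?thesis using leg_dist_invariant that unfolding d_def by (cases T0) blast
  qed
  have d_path: "d a b = path_length len (G.tree_path (leg \<tau> a) (leg \<tau> b))" for a b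
    unfolding d_def using st by (rule leg_dist_eq)
  have d_sym: "d b a = d a b" if "a \<in> {1..n}" "b \<in> {1..n}" for a b
    unfolding d_path using G.tree_path_swap[OF legs[OF that(1)] legs[OF that(2)]]
    by (simp add: path_length_rev_path)
  obtain c where c: "\<And>a b. a \<in> {1..n} \<Longrightarrow> b \<in> {1..n} \<Longrightarrow> a < b \<Longrightarrow>
      - leg_dist T0 a b / 2 = c a + c b + v (minor L p a b)"
    using lin unfolding lineality_equiv_def by blast
  have pc: "p a \<in> carrier L \<times> carrier L" if "a \<in> {1..n}" for a
    using p that by (simp add: marked_line_def)
  have minor: "v (minor L p a b) = - d a b / 2 - c a - c b"
    if ab: "a \<in> {1..n}" "b \<in> {1..n}" "a \<noteq> b" for a b
  proof (cases "a < b")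
    case True
    then show ?thesis using c[OF ab(1,2)] d0[OF ab(1,2)] by simp
  next
    case False
    then have "b < a" using ab by simp
    have "minor L p a b \<in> carrier L"
      using pc[OF ab(1)] pc[OF ab(2)] by (simp add: minor_def mem_Times_iff)
    moreover have "minor L p a b \<noteq> \<zero>\<^bsub>L\<^esub>" using p ab by (simp add: marked_line_def)
    ultimately have "v (minor L p b a) = v (minor L p a b)"
      unfolding L.minor_swap[of p a b, OF pc[OF ab(1)] pc[OF ab(2)]] by (rule L.valuation_minus)
    then show ?thesis using c[OF ab(2,1) \<open>b < a\<close>] d0[OF ab(2,1)] d_sym[OF ab(1,2)] by simp
  qed
  have ij: "i \<in> {1..n}" "j \<in> {1..n}" using S by auto
  have shift: "real l * real B ^ (n - 3 - q) + (v (minor L p l j) - v (minor L p l i))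
      = (real l * real B ^ (n - 3 - q) + sum len (G.stem (leg \<tau> i) (leg \<tau> j) (leg \<tau> l)))
        + (c i - c j - d i j / 2)" if "l \<in> S - {i, j}" for l
  proof -
    have l: "l \<in> {1..n}" "l \<noteq> i" "l \<noteq> j" using that S by auto
    have "d l i - d l j = 2 * sum len (G.stem (leg \<tau> i) (leg \<tau> j) (leg \<tau> l)) - d i j"
      unfolding d_path using G.path_length_difference[OF legs[OF ij(1)] legs[OF ij(2)] legs[OF l(1)]] .
    then show ?thesis using minor[OF l(1) ij(1) l(2)] minor[OF l(1) ij(2) l(3)] by linarith
  qed
  have "min_attained_twice (S - {i, j})
    (\<lambda>l. real l * real B ^ (n - 3 - q) + (v (minor L p l j) - v (minor L p l i)))"
    using ext p Zp S by (rule min_attained_twice_on_hypersurface)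
  moreover have "min_attained_twice (S - {i, j})
      (\<lambda>l. real l * real B ^ (n - 3 - q) + (v (minor L p l j) - v (minor L p l i)))
    \<longleftrightarrow> min_attained_twice (S - {i, j}) (\<lambda>l. real l * real B ^ (n - 3 - q)
      + sum len (G.stem (leg \<tau> i) (leg \<tau> j) (leg \<tau> l)))"
    by (rule min_attained_twice_shift[where C = "c i - c j - d i j / 2"]) (rule shift)
  ultimately show ?thesis by blast
qed

lemma card_edges_Sigma_trop:
  assumes "\<Gamma> \<in> Sigma_trop n r" "(\<tau>, len) \<in> \<Gamma>"
  shows "card (edges (graph_of \<tau>)) \<le> r"
proof -
  obtain \<tau>0 len0 where M: "\<Gamma> \<in> M0n_trop n" and T0: "(\<tau>0, len0) \<in> \<Gamma>"
    and card: "card (edges (graph_of \<tau>0)) \<le> r"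
    using assms(1) by (auto simp: Sigma_trop_def)
  have "((\<tau>, len), (\<tau>0, len0)) \<in> metric_rel n" using M0n_tropD(1)[OF M assms(2)] T0 by simp
  then obtain f where "tree_iso n f \<tau> \<tau>0" "\<tau> \<in> stable_trees n" "\<tau>0 \<in> stable_trees n"
    by (auto simp: metric_rel_def metric_trees_def)
  then show ?thesis using tree_iso_card_edges card by metis
qed

text \<open>
  An isomorphism of the underlying trees transports the metric of \<open>\<Gamma>\<close> to the tree \<open>\<tau>'\<close> of \<open>\<Gamma>'\<close>.  The stems
  on \<open>\<tau>'\<close> are then common to both metrics, and uniqueness of the solution applies.
\<close>

lemma FW_determined_by_underlying_tree:
  fixes n m B r :: nat and S :: "nat \<Rightarrow> nat set" and i j :: "nat \<Rightarrow> nat"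
  assumes m: "m \<le> n - 3"
    and S: "\<forall>q\<in>{1..m}. S q \<subseteq> {1..n} \<and> card (S q) \<ge> 3"
    and ij: "\<forall>q\<in>{1..m}. i q \<in> S q \<and> j q \<in> S q \<and> i q \<noteq> j q"
    and B: "B \<ge> 2 * n + 1" and r: "r \<le> m"
    and \<Gamma>: "\<Gamma> \<in> FW TYPE('k::{alg_closed_field,field_char_0}) TYPE('u) n B S i j r"
    and \<Gamma>': "\<Gamma>' \<in> FW TYPE('k) TYPE('u) n B S i j r"
    and same: "underlying_tree n \<Gamma> = underlying_tree n \<Gamma>'"
  shows "\<Gamma> = \<Gamma>'"
proof -
  have M: "\<Gamma> \<in> M0n_trop n" "\<Gamma>' \<in> M0n_trop n"
    using \<Gamma> \<Gamma>' by (auto simp: FW_def Sigma_trop_def)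
  obtain T where "T \<in> metric_trees n" "\<Gamma> = metric_rel n `` {T}"
    using M(1) unfolding M0n_trop_def by (auto elim: quotientE)
  moreover obtain \<tau> len where "T = (\<tau>, len)" by (cases T)
  ultimately have T: "(\<tau>, len) \<in> metric_trees n" "(\<tau>, len) \<in> \<Gamma>"
    using equiv_class_self[OF equiv_metric_rel] by auto
  have st: "\<tau> \<in> stable_trees n" using T by (simp add: metric_trees_def)
  have "(\<tau>, \<tau>) \<in> tree_rel n" using st tree_iso_id by (auto simp: tree_rel_def)
  then have "\<tau> \<in> underlying_tree n \<Gamma>"
    unfolding underlying_tree_def using T(2) by force
  then have "\<tau> \<in> underlying_tree n \<Gamma>'" using same by simp
  then obtain \<tau>' len0 f where T0: "(\<tau>', len0) \<in> \<Gamma>'" and iso: "tree_iso n f \<tau>' \<tau>"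
    by (auto simp: underlying_tree_def tree_rel_def)
  have T0': "(\<tau>', len0) \<in> metric_trees n" using M0n_tropD(2)[OF M(2) T0] .
  then have st': "\<tau>' \<in> stable_trees n" by (simp add: metric_trees_def)
  define len' where "len' e = len (f ` e)" for e
  have T': "(\<tau>', len') \<in> metric_trees n"
    using T(1) st' tree_iso_edges[OF iso st' st] by (auto simp: metric_trees_def len'_def)
  have "((\<tau>', len'), (\<tau>, len)) \<in> metric_rel n"
    using T' T(1) iso by (rule metric_relI) (simp add: len'_def)
  then have "((\<tau>, len), (\<tau>', len')) \<in> metric_rel n"
    using equiv_metric_rel by (meson equiv_def symD)
  then have T'_in: "(\<tau>', len') \<in> \<Gamma>" using M0n_tropD(1)[OF M(1) T(2)] by simp

  interpret G: unique_path_tree "graph_of \<tau>'" using st' by (rule unique_path_tree_if_stable)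
  define N where "N q l = G.stem (leg \<tau>' (i q)) (leg \<tau>' (j q)) (leg \<tau>' l)" for q l
  have qm: "q \<in> {1..m}" if "q \<in> {1..r}" for q using that r by auto
  interpret scaled_chains n B "n - 3" r "edges (graph_of \<tau>')" "\<lambda>q. S q - {i q, j q}" N
  proof
    show "finite (edges (graph_of \<tau>'))" by (rule G.finite_edges)
    show "card (edges (graph_of \<tau>')) \<le> r"
      using \<Gamma> T'_in by (intro card_edges_Sigma_trop) (auto simp: FW_def)
    show "r \<le> n - 3" using r m by simp
    show "2 * n + 1 \<le> B" by (rule B)
    fix q assume q: "q \<in> {1..r}"
    show "S q - {i q, j q} \<subseteq> {1..n}" using S qm[OF q] by blast
    fix l
    have "i q \<in> {1..n}" "j q \<in> {1..n}" using S ij qm[OF q] by blast+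
    then show "N q l \<subseteq> edges (graph_of \<tau>')"
      unfolding N_def using leg_in_pverts[OF st'] by (intro G.stem_subset) auto
    show "N q l \<subseteq> N q l' \<or> N q l' \<subseteq> N q l" for l'
      unfolding N_def by (rule G.stem_chain)
  qed
  have sol: "solution len1"
    if \<Delta>: "\<Delta> \<in> FW TYPE('k) TYPE('u) n B S i j r" "(\<tau>', len1) \<in> \<Delta>"
      and len1: "(\<tau>', len1) \<in> metric_trees n" for \<Delta> len1
    unfolding solution_def W_def N_def
  proof (intro conjI ballI)
    show "0 < len1 e" if "e \<in> edges (graph_of \<tau>')" for e
      using that len1 by (auto simp: metric_trees_def)
    fix q assume q: "q \<in> {1..r}"
    have "\<Delta> \<in> Trop n (hypersurface n B (S q) (i q) (j q) q :: ('k, 'u) subscheme)"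
      using \<Delta>(1) q by (auto simp: FW_def)
    then show "min_attained_twice (S q - {i q, j q}) (\<lambda>l. real l * real B ^ (n - 3 - q)
      + sum len1 (G.stem (leg \<tau>' (i q)) (leg \<tau>' (j q)) (leg \<tau>' l)))"
      using \<Delta>(2) S ij qm[OF q] by (intro Trop_hypersurface_min[OF _ refl]) auto
  qed
  have "len' e = len0 e" if "e \<in> edges (graph_of \<tau>')" for e
    using sol[OF \<Gamma> T'_in T'] sol[OF \<Gamma>' T0 T0'] that by (rule solution_unique)
  then have "((\<tau>', len0), (\<tau>', len')) \<in> metric_rel n"
    using T0' T' tree_iso_id by (intro metric_relI[where f = id]) auto
  then have "metric_rel n `` {(\<tau>', len0)} = metric_rel n `` {(\<tau>', len')}"
    by (rule equiv_class_eq[OF equiv_metric_rel])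
  then show ?thesis using M0n_tropD(1)[OF M(1) T'_in] M0n_tropD(1)[OF M(2) T0] by simp
qed

theorem proposition9p17:
  fixes n m B r :: nat
    and S :: "nat \<Rightarrow> nat set"
    and i j :: "nat \<Rightarrow> nat"
  assumes "n \<ge> 3"
    and "m \<le> n - 3"
    and "\<forall>q\<in>{1..m}. S q \<subseteq> {1..n} \<and> card (S q) \<ge> 3"
    and "\<forall>q\<in>{1..m}. i q \<in> S q \<and> j q \<in> S q \<and> i q \<noteq> j q"
    and "B \<ge> 2 * n + 1"
    and "r \<le> m"
  shows "(\<forall>\<Gamma> \<in> FW TYPE('k::{alg_closed_field,field_char_0}) TYPE('u) n B S i j r.
          \<forall>\<Gamma>' \<in> FW TYPE('k) TYPE('u) n B S i j r.
            \<Gamma> \<noteq> \<Gamma>' \<longrightarrow> underlying_tree n \<Gamma> \<noteq> underlying_tree n \<Gamma>') \<and>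
         (\<forall>c \<in> stable_trees n // tree_rel n.
            \<exists>\<^sub>\<le>\<^sub>1 \<Gamma>. \<Gamma> \<in> FW TYPE('k) TYPE('u) n B S i j r \<inter> cone_relint n c)"
proof -
  note determined = FW_determined_by_underlying_tree[OF assms(2-6)]
  show ?thesis
    by (intro conjI ballI impI notI Uniq_I) (auto simp: cone_relint_def dest: determined)
qed

end
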